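(* Let $\mathcal{D}$ be the generating class of a decomposable model for $m$-way contingency tables. The model has a clique tree $\mathcal{T}$ such that $\mathcal{M}^{\mathcal{T}}$ is a minimal Markov basis if and only if the model has a unique minimal Markov basis.
   Context: Let $\Delta=\{1,\dots,m\}$ be the set of variables; variable $\delta$ has level set $\mathcal{I}_\delta=\{0,1,\dots,I_\delta-1\}$ with $I_\delta\ge2$, and the cells are $i=(i_1,\dots,i_m)\in\mathcal{I}=\prod_{\delta\in\Delta}\mathcal{I}_\delta$. A contingency table is a nonnegative integer array $\mathbf{n}=\{n(i)\}_{i\in\mathcal{I}}$. For $D\subset\Delta$, $\mathcal{I}_D=\prod_{\delta\in D}\mathcal{I}_\delta$, and the $D$-marginal table $\mathbf{n}_D$ has entries $n_D(i_D)=\sum_{i_{D^C}\in\mathcal{I}_{D^C}}n(i_D,i_{D^C})$. The generating class $\mathcal{D}=\{D_1,\dots,D_r\}$ is the set of facets of a simplicial complex with $\bigcup_jD_j=\Delta$. The independence graph $\mathcal{G}^{\mathcal{D}}$ has vertex set $\Delta$, with distinct $\delta,\delta'$ adjacent iff $\delta,\delta'\in D$ for some $D\in\mathcal{D}$. The model is decomposable if $\mathcal{D}$ is the set of maximal cliques of $\mathcal{G}^{\mathcal{D}}$ and $\mathcal{G}^{\mathcal{D}}$ is chordal (every cycle of length greater than three has a chord). A clique tree of $\mathcal{G}^{\mathcal{D}}$ is a tree $\mathcal{T}=(\mathcal{D},\mathcal{E})$ with vertex set $\mathcal{D}$ such that $D_s\cap D_t\subset D_u$ for every $D_u$ on the path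 between $D_s$ and $D_t$ in $\mathcal{T}$ (also when $\mathcal{G}^{\mathcal{D}}$ is disconnected; empty intersections of neighbouring cliques are allowed). The marginal frequencies of $\mathbf{n}$ are $\mathbf{b}=A\mathbf{n}=\{n_{D_j}(i_{D_j}) : i_{D_j}\in\mathcal{I}_{D_j},\ j=1,\dots,r\}$, and the fiber is $\mathcal{F}_{\mathbf{b}}=\{\mathbf{n}\ge 0\mid A\mathbf{n}=\mathbf{b}\}$. A move for $\mathcal{D}$ is an integer array $\mathbf{z}=\{z(i)\}_{i\in\mathcal{I}}$ with $A\mathbf{z}=\mathbf{0}$, i.e. all its $D$-marginals, $D\in\mathcal{D}$, vanish. A primitive move is a square-free move of degree two, i.e. a move with exactly two entries $+1$, exactly two entries $-1$ and all others $0$. A finite set $\mathcal{M}$ of moves is a Markov basis if for every fiber $\mathcal{F}_{\mathbf{b}}$, any two elements of $\mathcal{F}_{\mathbf{b}}$ can be joined by a finite sequence of elements of $\mathcal{F}_{\mathbf{b}}$ in which consecutive tables differ by $\pm\mathbf{z}$ with $\mathbf{z}\in\mathcal{M}$. A Markov basis is minimal if no proper subset of it is a Markov basis. Moves are considered up to sign ($\mathbf{z}$ is identified with $-\mathbf{z}$); minimality and uniqueness are understood with this identification. For an edge $e\in\mathcal{E}$ of a clique tree $\mathcal{T}$, let $\mathcal{T}_e=(\mathcal{D}_e,\mathcal{E}_e)$ and $\mathcal{T}'_e=(\mathcal{D}'_e,\mathcal{E}'_e)$ be the two subtrees obtained by removing $e$, and put $V_e=\bigcup_{D\in\mathcal{D}_e}D$,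 $V'_e=\bigcup_{D\in\mathcal{D}'_e}D$. Let $\mathcal{M}^{\mathcal{T}}(V_e,V'_e)$ be the set of all primitive moves for the decomposable model with generating class $\{V_e,V'_e\}$. Then $\mathcal{M}^{\mathcal{T}}=\bigcup_{e\in\mathcal{E}}\mathcal{M}^{\mathcal{T}}(V_e,V'_e)$ (which is known, by Dobra, to be a Markov basis for $\mathcal{D}$). *)

theory Defs
  imports Main "HOL-Library.FuncSet" "HOL-Library.Ramsey"
begin

text \<open>A graph is given by a vertex set \<open>V\<close> and a set \<open>E\<close> of two-element subsets of \<open>V\<close>,
  which is the convention of \<^const>\<open>clique\<close>.\<close>

definition simple_graph :: "'a set \<Rightarrow> 'a set set \<Rightarrow> bool" where
  "simple_graph V E \<longleftrightarrow> (\<forall>e\<in>E. \<exists>u\<in>V. \<exists>v\<in>V. u \<noteq> v \<and> e = {u, v})"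

definition is_path :: "'a set \<Rightarrow> 'a set set \<Rightarrow> 'a \<Rightarrow> 'a list \<Rightarrow> 'a \<Rightarrow> bool" where
  "is_path V E u p v \<longleftrightarrow>
     p \<noteq> [] \<and> hd p = u \<and> last p = v \<and> set p \<subseteq> V \<and> distinct p \<and>
     successively (\<lambda>x y. {x, y} \<in> E) p"

definition cycle_edges :: "'a list \<Rightarrow> 'a set set" where
  "cycle_edges c = {{c ! i, c ! (Suc i mod length c)} | i. i < length c}"

text \<open>A cycle is listed without repeating its starting vertex.\<close>

definition is_cycle :: "'a set \<Rightarrow> 'a set set \<Rightarrow> 'a list \<Rightarrow> bool" where
  "is_cycle V E c \<longleftrightarrow> 3 \<le> length c \<and> distinct c \<and> set c \<subseteq> V \<and> cycle_edges c \<subseteq> E"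

definition has_chord :: "'a set set \<Rightarrow> 'a list \<Rightarrow> bool" where
  "has_chord E c \<longleftrightarrow> (\<exists>u\<in>set c. \<exists>v\<in>set c. {u, v} \<in> E \<and> {u, v} \<notin> cycle_edges c)"

definition chordal :: "'a set \<Rightarrow> 'a set set \<Rightarrow> bool" where
  "chordal V E \<longleftrightarrow> (\<forall>c. is_cycle V E c \<and> 3 < length c \<longrightarrow> has_chord E c)"

definition maximal_cliques :: "'a set \<Rightarrow> 'a set set \<Rightarrow> 'a set set" where
  "maximal_cliques V E =
     {C. C \<subseteq> V \<and> clique C E \<and> \<not> (\<exists>C'. C \<subset> C' \<and> C' \<subseteq> V \<and> clique C' E)}"

definition is_tree :: "'a set \<Rightarrow> 'a set set \<Rightarrow> bool" where
  "is_tree V E \<longleftrightarrow>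
     simple_graph V E \<and> V \<noteq> {} \<and>
     (\<forall>u\<in>V. \<forall>v\<in>V. \<exists>p. is_path V E u p v) \<and>
     \<not> (\<exists>c. is_cycle V E c)"

definition component :: "'a set \<Rightarrow> 'a set set \<Rightarrow> 'a \<Rightarrow> 'a set" where
  "component V E u = {v. \<exists>p. is_path V E u p v}"

definition simplicial_complex :: "'v set \<Rightarrow> 'v set set \<Rightarrow> bool" where
  "simplicial_complex \<Delta> K \<longleftrightarrow> K \<noteq> {} \<and> K \<subseteq> Pow \<Delta> \<and> (\<forall>F\<in>K. \<forall>F'. F' \<subseteq> F \<longrightarrow> F' \<in> K)"

definition facets :: "'v set set \<Rightarrow> 'v set set" where
  "facets K = {F \<in> K. \<not> (\<exists>F'\<in>K. F \<subset> F')}"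

definition generating_class :: "'v set \<Rightarrow> 'v set set \<Rightarrow> bool" where
  "generating_class \<Delta> \<D> \<longleftrightarrow> (\<exists>K. simplicial_complex \<Delta> K \<and> \<D> = facets K) \<and> \<Union>\<D> = \<Delta>"

definition independence_edges :: "'v set set \<Rightarrow> 'v set set" where
  "independence_edges \<D> = {{u, v} | u v. u \<noteq> v \<and> (\<exists>D\<in>\<D>. u \<in> D \<and> v \<in> D)}"

definition decomposable :: "'v set \<Rightarrow> 'v set set \<Rightarrow> bool" where
  "decomposable \<Delta> \<D> \<longleftrightarrow>
     \<D> = maximal_cliques \<Delta> (independence_edges \<D>) \<and> chordal \<Delta> (independence_edges \<D>)"

definition clique_tree :: "'v set set \<Rightarrow> 'v set set set \<Rightarrow> bool" where
  "clique_tree \<D> E \<longleftrightarrow>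
     is_tree \<D> E \<and>
     (\<forall>Ds\<in>\<D>. \<forall>Dt\<in>\<D>. \<forall>p. is_path \<D> E Ds p Dt \<longrightarrow> (\<forall>Du\<in>set p. Ds \<inter> Dt \<subseteq> Du))"

text \<open>The parameter \<open>lv\<close> gives the numbers of levels \<open>I\<^sub>\<delta>\<close> of the variables.  Cells of the
  \<open>D\<close>-marginal are extensional functions on \<open>D\<close>; arrays are integer functions that vanish off
  the cells, so that distinct functions are distinct arrays.\<close>

definition cells :: "('v \<Rightarrow> nat) \<Rightarrow> 'v set \<Rightarrow> ('v \<Rightarrow> nat) set" where
  "cells lv D = (\<Pi>\<^sub>E \<delta>\<in>D. {..<lv \<delta>})"

definition arrays :: "'v set \<Rightarrow> ('v \<Rightarrow> nat) \<Rightarrow> (('v \<Rightarrow> nat) \<Rightarrow> int) set" where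
  "arrays \<Delta> lv = {n. \<forall>i. i \<notin> cells lv \<Delta> \<longrightarrow> n i = 0}"

definition tables :: "'v set \<Rightarrow> ('v \<Rightarrow> nat) \<Rightarrow> (('v \<Rightarrow> nat) \<Rightarrow> int) set" where
  "tables \<Delta> lv = {n \<in> arrays \<Delta> lv. \<forall>i. 0 \<le> n i}"

text \<open>Here \<open>override_on j i D\<close> is the cell \<open>(i\<^sub>D, i\<^sub>D\<^sub>c)\<close> with \<open>i\<^sub>D = i\<close> and \<open>i\<^sub>D\<^sub>c = j\<close>.\<close>

definition marginal ::
    "'v set \<Rightarrow> ('v \<Rightarrow> nat) \<Rightarrow> (('v \<Rightarrow> nat) \<Rightarrow> int) \<Rightarrow> 'v set \<Rightarrow> ('v \<Rightarrow> nat) \<Rightarrow> int" where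
  "marginal \<Delta> lv n D i = (\<Sum>j\<in>cells lv (\<Delta> - D). n (override_on j i D))"

definition marginal_freqs ::
    "'v set \<Rightarrow> ('v \<Rightarrow> nat) \<Rightarrow> 'v set set \<Rightarrow> (('v \<Rightarrow> nat) \<Rightarrow> int) \<Rightarrow> 'v set \<Rightarrow> ('v \<Rightarrow> nat) \<Rightarrow> int" where
  "marginal_freqs \<Delta> lv \<D> n = (\<lambda>D\<in>\<D>. \<lambda>i\<in>cells lv D. marginal \<Delta> lv n D i)"

definition fiber ::
    "'v set \<Rightarrow> ('v \<Rightarrow> nat) \<Rightarrow> 'v set set \<Rightarrow> ('v set \<Rightarrow> ('v \<Rightarrow> nat) \<Rightarrow> int)
       \<Rightarrow> (('v \<Rightarrow> nat) \<Rightarrow> int) set" where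
  "fiber \<Delta> lv \<D> b = {n \<in> tables \<Delta> lv. marginal_freqs \<Delta> lv \<D> n = b}"

definition moves :: "'v set \<Rightarrow> ('v \<Rightarrow> nat) \<Rightarrow> 'v set set \<Rightarrow> (('v \<Rightarrow> nat) \<Rightarrow> int) set" where
  "moves \<Delta> lv \<D> =
     {z \<in> arrays \<Delta> lv. \<forall>D\<in>\<D>. \<forall>i\<in>cells lv D. marginal \<Delta> lv z D i = 0}"

definition primitive_moves :: "'v set \<Rightarrow> ('v \<Rightarrow> nat) \<Rightarrow> 'v set set \<Rightarrow> (('v \<Rightarrow> nat) \<Rightarrow> int) set" where
  "primitive_moves \<Delta> lv \<D> =
     {z \<in> moves \<Delta> lv \<D>.
        card {i \<in> cells lv \<Delta>. z i = 1} = 2 \<and>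
        card {i \<in> cells lv \<Delta>. z i = -1} = 2 \<and>
        (\<forall>i\<in>cells lv \<Delta>. z i \<in> {-1, 0, 1})}"

definition fiber_steps ::
    "('c \<Rightarrow> int) set \<Rightarrow> ('c \<Rightarrow> int) set \<Rightarrow> (('c \<Rightarrow> int) \<times> ('c \<Rightarrow> int)) set" where
  "fiber_steps F M =
     {(x, y). x \<in> F \<and> y \<in> F \<and>
        (\<exists>z\<in>M. (\<forall>i. y i = x i + z i) \<or> (\<forall>i. y i = x i - z i))}"

definition markov_basis ::
    "'v set \<Rightarrow> ('v \<Rightarrow> nat) \<Rightarrow> 'v set set \<Rightarrow> (('v \<Rightarrow> nat) \<Rightarrow> int) set \<Rightarrow> bool" where
  "markov_basis \<Delta> lv \<D> M \<longleftrightarrow>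
     finite M \<and> M \<subseteq> moves \<Delta> lv \<D> \<and>
     (\<forall>b. \<forall>x\<in>fiber \<Delta> lv \<D> b. \<forall>y\<in>fiber \<Delta> lv \<D> b.
        (x, y) \<in> (fiber_steps (fiber \<Delta> lv \<D> b) M)\<^sup>*)"

text \<open>Moves are identified up to sign: two sets of moves count as equal iff they have the same
  set of classes \<open>{z, -z}\<close>, and a subset is proper iff it misses a whole class.\<close>

definition sign_classes :: "('c \<Rightarrow> int) set \<Rightarrow> ('c \<Rightarrow> int) set set" where
  "sign_classes M = (\<lambda>z. {z, (\<lambda>i. - z i)}) ` M"

definition minimal_markov_basis ::
    "'v set \<Rightarrow> ('v \<Rightarrow> nat) \<Rightarrow> 'v set set \<Rightarrow> (('v \<Rightarrow> nat) \<Rightarrow> int) set \<Rightarrow> bool" where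
  "minimal_markov_basis \<Delta> lv \<D> M \<longleftrightarrow>
     markov_basis \<Delta> lv \<D> M \<and>
     \<not> (\<exists>N. markov_basis \<Delta> lv \<D> N \<and> sign_classes N \<subset> sign_classes M)"

definition unique_minimal_markov_basis :: "'v set \<Rightarrow> ('v \<Rightarrow> nat) \<Rightarrow> 'v set set \<Rightarrow> bool" where
  "unique_minimal_markov_basis \<Delta> lv \<D> \<longleftrightarrow>
     (\<exists>!B. \<exists>M. minimal_markov_basis \<Delta> lv \<D> M \<and> B = sign_classes M)"

text \<open>For an edge \<open>e = {D, D'}\<close>, \<open>edge_generating_class \<D> E e\<close> is \<open>{V\<^sub>e, V'\<^sub>e}\<close>: the two components left after deleting
  \<open>e\<close> are those of its end vertices \<open>D\<close> and \<open>D'\<close>.\<close>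

definition edge_generating_class :: "'v set set \<Rightarrow> 'v set set set \<Rightarrow> 'v set set \<Rightarrow> 'v set set" where
  "edge_generating_class \<D> E e = (\<lambda>D. \<Union>(component \<D> (E - {e}) D)) ` e"

definition clique_tree_moves ::
    "'v set \<Rightarrow> ('v \<Rightarrow> nat) \<Rightarrow> 'v set set \<Rightarrow> 'v set set set \<Rightarrow> (('v \<Rightarrow> nat) \<Rightarrow> int) set" where
  "clique_tree_moves \<Delta> lv \<D> E =
     (\<Union>e\<in>E. primitive_moves \<Delta> lv (edge_generating_class \<D> E e))"

end

theory Submission
  imports Defs "HOL-Library.Multiset"
begin

text \<open>
  Both sides are equivalent to the condition that no three vertices of the independence graph are
  pairwise nonadjacent.

  If there is such a triple, then giving its three coordinates the values 0 and 1 and all others the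
  value 0 yields a fiber with four tables of total 2. In this fiber the moves of a clique tree form
  classes of two parallel edges, so they contain a 4-cycle as soon as they connect the fiber, and one
  of its edges is superfluous. Moreover, every edge in a minimal Markov basis can be traded for a
  detour through a third table, so that no minimal Markov basis is the only one.

  If there is no such triple, then a fiber of degree two has at most two elements, since its
  elements correspond to ways of exchanging connected parts of the differing coordinates. Hence
  every Markov basis contains all primitive moves of the model up to sign, and it suffices to find
  one clique tree whose moves are a Markov basis. As the graph is chordal, its vertices are covered
  by two cliques, which makes the maximal cliques a linearly ordered path; along this path one table
  is transformed into another clique by clique, swapping the coordinates behind a separator.
\<close>

section \<open>Tables as multisets of cells\<close>

text \<open>Fibers of total 2 decide everything because such a fiber is a list of exchange patterns:
  if \<open>{#i, j#}\<close> and \<open>{#k, l#}\<close> have the same clique margins, then on each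
  clique the pair \<open>k, l\<close> equals \<open>i, j\<close> or \<open>j, i\<close>, so the
  coordinates of a clique are exchanged together or not at all. An independent triple allows its
  three coordinates to be exchanged independently, in 8 ways; since the two cells are unordered, 4
  tables remain. Any set \<open>primitive_moves \<Delta> lv G\<close> is defined by equality of
  margins, which is invariant under flipping one coordinate; this is where the parallel edges come
  from. Without such a triple, it is enough to find moves that form a Markov basis and that every
  Markov basis must contain: a least basis is minimal and unique at once. Connectivity then has to
  be proved only for a path, by induction along a list of cliques. Tables are treated as multisets
  of cells, so that margins become images, total 2 means two cells, and large tables can be handled
  one cell at a time.\<close>

definition table_of :: "'c multiset \<Rightarrow> 'c \<Rightarrow> int" where
  "table_of X = (\<lambda>i. int (count X i))"

definition margin :: "'v set \<Rightarrow> ('v \<Rightarrow> nat) multiset \<Rightarrow> ('v \<Rightarrow> nat) multiset" where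
  "margin D X = image_mset (\<lambda>x. restrict x D) X"

lemma table_of_inject [simp]: "table_of X = table_of Y \<longleftrightarrow> X = Y"
  by (auto simp: table_of_def fun_eq_iff multiset_eq_iff)

lemma table_of_add: "table_of (X + Y) = (\<lambda>i. table_of X i + table_of Y i)"
  by (auto simp: table_of_def)

lemma margin_simps [simp]:
  "margin D {#} = {#}"
  "margin D (add_mset x X) = add_mset (restrict x D) (margin D X)"
  "margin D (X + Y) = margin D X + margin D Y"
  "size (margin D X) = size X"
  by (auto simp: margin_def)

lemma margin_margin: "C \<subseteq> D \<Longrightarrow> margin C (margin D X) = margin C X"
  by (auto simp: margin_def multiset.map_comp Int_absorb1 intro!: image_mset_cong)

lemma margin_mono: "C \<subseteq> D \<Longrightarrow> margin D X = margin D Y \<Longrightarrow> margin C X = margin C Y"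
  by (metis margin_margin)

lemma restrict_cells: "x \<in> cells lv \<Delta> \<Longrightarrow> D \<subseteq> \<Delta> \<Longrightarrow> restrict x D \<in> cells lv D"
  by (auto simp: cells_def PiE_iff)

lemma finite_cells: "finite \<Delta> \<Longrightarrow> finite (cells lv \<Delta>)"
  by (auto simp: cells_def intro!: finite_PiE)

lemma restrict_cell_same: "x \<in> cells lv \<Delta> \<Longrightarrow> restrict x \<Delta> = x"
  by (auto simp: cells_def)

lemma margin_same: "set_mset X \<subseteq> cells lv \<Delta> \<Longrightarrow> margin \<Delta> X = X"
  unfolding margin_def using restrict_cell_same
  by (subst image_mset_cong[where g = id]) auto

lemma tableE:
  assumes "finite \<Delta>" "x \<in> tables \<Delta> lv"
  obtains X where "x = table_of X" "set_mset X \<subseteq> cells lv \<Delta>"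
proof -
  have fin: "finite {i. 0 < nat (x i)}"
    by (rule finite_subset[OF _ finite_cells[OF assms(1), of lv]])
      (use assms(2) in \<open>auto simp: tables_def arrays_def; fastforce\<close>)
  define X where "X = Abs_multiset (\<lambda>i. nat (x i))"
  have c: "count X = (\<lambda>i. nat (x i))"
    unfolding X_def using fin by (rule count_Abs_multiset)
  have "x = table_of X"
    using assms(2) by (auto simp: table_of_def c tables_def)
  moreover have "set_mset X \<subseteq> cells lv \<Delta>"
    using assms(2) unfolding set_mset_def c by (auto simp: tables_def arrays_def; fastforce)
  ultimately show ?thesis using that by blast
qed

lemma table_of_tables [simp]: "table_of X \<in> tables \<Delta> lv \<longleftrightarrow> set_mset X \<subseteq> cells lv \<Delta>"
  by (auto simp: tables_def arrays_def table_of_def count_eq_zero_iff)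

text \<open>The cells restricting to \<open>t\<close> are exactly the completions of
  \<open>t\<close> by a complementary cell, so the defining sum counts the preimages of
  \<open>t\<close> in \<open>X\<close>. This is the bridge from arrays to multisets.\<close>

lemma marginal_table_of:
  assumes "finite \<Delta>" "D \<subseteq> \<Delta>" "t \<in> cells lv D" "set_mset X \<subseteq> cells lv \<Delta>"
  shows "marginal \<Delta> lv (table_of X) D t = int (count (margin D X) t)"
proof -
  let ?S = "{x \<in> cells lv \<Delta>. restrict x D = t}"
  have "marginal \<Delta> lv (table_of X) D t = (\<Sum>x\<in>?S. table_of X x)"
    unfolding marginal_def
  proof (rule sum.reindex_bij_witness[where j = "\<lambda>j. override_on j t D" and i = "\<lambda>x. restrict x (\<Delta> - D)"])
    fix j assume j: "j \<in> cells lv (\<Delta> - D)"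
    show "restrict (override_on j t D) (\<Delta> - D) = j"
      using j by (auto simp: cells_def fun_eq_iff override_on_def PiE_iff extensional_def)
    show "override_on j t D \<in> ?S"
      using j assms(2,3)
      by (auto simp: cells_def fun_eq_iff override_on_def PiE_iff extensional_def split: if_splits)
  next
    fix x assume x: "x \<in> ?S"
    show "override_on (restrict x (\<Delta> - D)) t D = x"
      using x assms(2) by (auto simp: cells_def fun_eq_iff override_on_def PiE_iff extensional_def) metis
    show "restrict x (\<Delta> - D) \<in> cells lv (\<Delta> - D)"
      using x by (auto simp: cells_def)
  qed auto
  also have "\<dots> = (\<Sum>x\<in>(\<lambda>x. restrict x D) -` {t} \<inter> set_mset X. table_of X x)"
    using assms(4) finite_cells[OF assms(1), of lv]
    by (intro sum.mono_neutral_right) (auto simp: table_of_def count_eq_zero_iff)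
  also have "\<dots> = int (count (margin D X) t)"
    by (simp add: margin_def count_image_mset table_of_def)
  finally show ?thesis .
qed

lemma margin_eq_iff_marginal:
  assumes "finite \<Delta>" "D \<subseteq> \<Delta>" "set_mset X \<subseteq> cells lv \<Delta>" "set_mset Y \<subseteq> cells lv \<Delta>"
  shows "margin D X = margin D Y \<longleftrightarrow>
    (\<forall>t\<in>cells lv D. marginal \<Delta> lv (table_of X) D t = marginal \<Delta> lv (table_of Y) D t)"
proof -
  have "count (margin D Z) t = 0" if "set_mset Z \<subseteq> cells lv \<Delta>" "t \<notin> cells lv D" for Z t
    using that restrict_cells[OF _ assms(2)] by (auto simp: count_eq_zero_iff margin_def)
  then show ?thesis
    using assms by (auto simp: multiset_eq_iff marginal_table_of)
qed

lemma marginal_diff: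
  "marginal \<Delta> lv (\<lambda>i. x i - y i) D t = marginal \<Delta> lv x D t - marginal \<Delta> lv y D t"
  "marginal \<Delta> lv (\<lambda>i. x i + y i) D t = marginal \<Delta> lv x D t + marginal \<Delta> lv y D t"
  "marginal \<Delta> lv (\<lambda>i. - x i) D t = - marginal \<Delta> lv x D t"
  by (auto simp: marginal_def sum_subtractf sum.distrib sum_negf)

lemma moves_uminus: "z \<in> moves \<Delta> lv \<D> \<Longrightarrow> (\<lambda>i. - z i) \<in> moves \<Delta> lv \<D>"
  by (auto simp: moves_def arrays_def marginal_diff)

lemma diff_moves_iff:
  assumes "finite \<Delta>" "\<Union>\<D> \<subseteq> \<Delta>" "set_mset X \<subseteq> cells lv \<Delta>" "set_mset Y \<subseteq> cells lv \<Delta>"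
  shows "(\<lambda>i. table_of X i - table_of Y i) \<in> moves \<Delta> lv \<D> \<longleftrightarrow> (\<forall>D\<in>\<D>. margin D X = margin D Y)"
proof -
  have "(\<lambda>i. table_of X i - table_of Y i) \<in> arrays \<Delta> lv"
    using assms(3,4) by (auto simp: arrays_def table_of_def) (metis not_in_iff subsetD)
  moreover have "D \<subseteq> \<Delta>" if "D \<in> \<D>" for D using that assms(2) by auto
  ultimately show ?thesis
    using margin_eq_iff_marginal[OF assms(1) _ assms(3,4)]
    by (auto simp: moves_def marginal_diff)
qed

lemma marginal_freqs_eq_iff:
  "marginal_freqs \<Delta> lv \<D> x = marginal_freqs \<Delta> lv \<D> y \<longleftrightarrow>
   (\<forall>D\<in>\<D>. \<forall>t\<in>cells lv D. marginal \<Delta> lv x D t = marginal \<Delta> lv y D t)"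
  unfolding marginal_freqs_def
  by (auto simp: fun_eq_iff restrict_def)

lemma marginal_freqs_table_of:
  assumes "finite \<Delta>" "\<Union>\<D> \<subseteq> \<Delta>" "set_mset X \<subseteq> cells lv \<Delta>" "set_mset Y \<subseteq> cells lv \<Delta>"
  shows "marginal_freqs \<Delta> lv \<D> (table_of X) = marginal_freqs \<Delta> lv \<D> (table_of Y) \<longleftrightarrow>
    (\<forall>D\<in>\<D>. margin D X = margin D Y)"
proof -
  have "D \<subseteq> \<Delta>" if "D \<in> \<D>" for D using that assms(2) by auto
  then show ?thesis
    using margin_eq_iff_marginal[OF assms(1) _ assms(3,4)]
    by (auto simp: marginal_freqs_eq_iff)
qed

section \<open>Markov bases\<close>

lemma fiber_steps_sym: "(x, y) \<in> fiber_steps F M \<Longrightarrow> (y, x) \<in> fiber_steps F M"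
  unfolding fiber_steps_def by clarsimp (metis add_diff_cancel_right' diff_add_cancel)

lemma fiber_steps_rtrancl_sym: "(x, y) \<in> (fiber_steps F M)\<^sup>* \<Longrightarrow> (y, x) \<in> (fiber_steps F M)\<^sup>*"
  by (meson fiber_steps_sym symI sym_rtrancl symE)

lemma fiber_steps_mono: "F \<subseteq> F' \<Longrightarrow> M \<subseteq> M' \<Longrightarrow> fiber_steps F M \<subseteq> fiber_steps F' M'"
  by (auto simp: fiber_steps_def)

text \<open>Adding a fixed table preserves both differences and nonnegativity. This lifts a walk
  between small tables, such as a swap of two cells, to all larger tables.\<close>

lemma fiber_steps_translate:
  assumes "(x, y) \<in> (fiber_steps (tables \<Delta> lv) M)\<^sup>*" "w \<in> tables \<Delta> lv"
  shows "((\<lambda>i. x i + w i), (\<lambda>i. y i + w i)) \<in> (fiber_steps (tables \<Delta> lv) M)\<^sup>*"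
  using assms(1)
proof (induction rule: rtrancl_induct)
  case (step y y')
  then have "((\<lambda>i. y i + w i), (\<lambda>i. y' i + w i)) \<in> fiber_steps (tables \<Delta> lv) M"
    using assms(2) by (fastforce simp: fiber_steps_def tables_def arrays_def)
  then show ?case using step by auto
qed auto

lemma table_steps_marginal_freqs:
  assumes "M \<subseteq> moves \<Delta> lv \<D>" "(x, y) \<in> fiber_steps (tables \<Delta> lv) M"
  shows "marginal_freqs \<Delta> lv \<D> x = marginal_freqs \<Delta> lv \<D> y"
proof -
  obtain z where z: "z \<in> moves \<Delta> lv \<D>" "y = (\<lambda>i. x i + z i) \<or> y = (\<lambda>i. x i - z i)"
    using assms by (auto simp: fiber_steps_def fun_eq_iff)
  then show ?thesis
    by (auto simp: marginal_freqs_eq_iff moves_def marginal_diff)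
qed

lemma table_steps_rtrancl_marginal_freqs:
  assumes "M \<subseteq> moves \<Delta> lv \<D>" "(x, y) \<in> (fiber_steps (tables \<Delta> lv) M)\<^sup>*"
  shows "marginal_freqs \<Delta> lv \<D> x = marginal_freqs \<Delta> lv \<D> y"
  using assms(2) by induction (auto dest: table_steps_marginal_freqs[OF assms(1)])

lemma table_steps_rtrancl_tables:
  assumes "(x, y) \<in> (fiber_steps (tables \<Delta> lv) M)\<^sup>*" "x \<in> tables \<Delta> lv"
  shows "y \<in> tables \<Delta> lv"
  using assms by induction (auto simp: fiber_steps_def)

lemma fiber_steps_tables_rtrancl:
  assumes "M \<subseteq> moves \<Delta> lv \<D>" "(x, y) \<in> (fiber_steps (tables \<Delta> lv) M)\<^sup>*" "x \<in> fiber \<Delta> lv \<D> b"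
  shows "(x, y) \<in> (fiber_steps (fiber \<Delta> lv \<D> b) M)\<^sup>*"
  using assms(2)
proof (induction rule: rtrancl_induct)
  case (step y y')
  have "y \<in> fiber \<Delta> lv \<D> b" "y' \<in> fiber \<Delta> lv \<D> b"
    using step assms(3) table_steps_rtrancl_marginal_freqs[OF assms(1) step(1)]
      table_steps_marginal_freqs[OF assms(1) step(2)]
    by (auto simp: fiber_def fiber_steps_def)
  then have "(y, y') \<in> fiber_steps (fiber \<Delta> lv \<D> b) M"
    using step by (auto simp: fiber_steps_def)
  then show ?case using step by auto
qed auto

text \<open>Moves preserve the marginals, so a walk through nonnegative tables stays in its fiber by
  itself. Later walks can therefore be taken in \<open>tables \<Delta> lv\<close> without carrying a
  fiber along.\<close>

lemma markov_basis_iff: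
  "markov_basis \<Delta> lv \<D> M \<longleftrightarrow> finite M \<and> M \<subseteq> moves \<Delta> lv \<D> \<and>
    (\<forall>x\<in>tables \<Delta> lv. \<forall>y\<in>tables \<Delta> lv.
       marginal_freqs \<Delta> lv \<D> x = marginal_freqs \<Delta> lv \<D> y \<longrightarrow>
       (x, y) \<in> (fiber_steps (tables \<Delta> lv) M)\<^sup>*)"
    (is "_ \<longleftrightarrow> _ \<and> _ \<and> ?C")
proof (intro iffI conjI)
  assume M: "markov_basis \<Delta> lv \<D> M"
  then show "finite M" "M \<subseteq> moves \<Delta> lv \<D>" by (auto simp: markov_basis_def)
  show ?C
  proof (intro ballI impI)
    fix x y assume *: "x \<in> tables \<Delta> lv" "y \<in> tables \<Delta> lv"
      "marginal_freqs \<Delta> lv \<D> x = marginal_freqs \<Delta> lv \<D> y"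
    let ?F = "fiber \<Delta> lv \<D> (marginal_freqs \<Delta> lv \<D> x)"
    have "(x, y) \<in> (fiber_steps ?F M)\<^sup>*"
      using * M by (auto simp: markov_basis_def fiber_def)
    moreover have "fiber_steps ?F M \<subseteq> fiber_steps (tables \<Delta> lv) M"
      by (rule fiber_steps_mono) (auto simp: fiber_def)
    ultimately show "(x, y) \<in> (fiber_steps (tables \<Delta> lv) M)\<^sup>*"
      using rtrancl_mono by blast
  qed
next
  assume *: "finite M \<and> M \<subseteq> moves \<Delta> lv \<D> \<and> ?C"
  show "markov_basis \<Delta> lv \<D> M"
    unfolding markov_basis_def
  proof (intro conjI allI ballI)
    fix b x y assume "x \<in> fiber \<Delta> lv \<D> b" "y \<in> fiber \<Delta> lv \<D> b"
    then show "(x, y) \<in> (fiber_steps (fiber \<Delta> lv \<D> b) M)\<^sup>*"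
      using * by (intro fiber_steps_tables_rtrancl) (auto simp: fiber_def)
  qed (use * in auto)
qed

text \<open>If \<open>z = u - v\<close> with disjoint supports and both \<open>x\<close> and
  \<open>x + z\<close> are nonnegative, then \<open>x\<close> dominates \<open>v\<close>. A walk
  from \<open>v\<close> to \<open>u\<close>, translated by \<open>x - v\<close>, thus replaces the
  step along \<open>z\<close> wherever that step is possible.\<close>

lemma markov_basis_replace:
  assumes M: "markov_basis \<Delta> lv \<D> M" and N: "finite N" "N \<subseteq> moves \<Delta> lv \<D>"
    and repl: "\<And>z. z \<in> M \<Longrightarrow> \<exists>u v. (u, v) \<in> (fiber_steps (tables \<Delta> lv) N)\<^sup>* \<and>
      (\<forall>i. z i = u i - v i \<and> 0 \<le> u i \<and> 0 \<le> v i \<and> (u i = 0 \<or> v i = 0))"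
  shows "markov_basis \<Delta> lv \<D> N"
proof -
  let ?R = "fiber_steps (tables \<Delta> lv) N"
  have plus: "(x, y) \<in> ?R\<^sup>*"
    if z: "z \<in> M" and x: "x \<in> tables \<Delta> lv" and y: "y \<in> tables \<Delta> lv" and
      yx: "\<And>i. y i = x i + z i" for x y z
  proof -
    obtain u v where uv: "(u, v) \<in> ?R\<^sup>*" and
      zi: "\<And>i. z i = u i - v i" "\<And>i. 0 \<le> u i" "\<And>i. 0 \<le> v i" "\<And>i. u i = 0 \<or> v i = 0"
      using repl[OF z] by blast
    \<comment> \<open>Where \<open>v\<close> is positive, \<open>u\<close> vanishes, so
      \<open>y = x - v\<close> there and nonnegativity of \<open>y\<close> gives
      \<open>v \<le> x\<close>.\<close>
    have w: "(\<lambda>i. x i - v i) \<in> tables \<Delta> lv"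
      unfolding tables_def arrays_def
    proof (clarsimp, intro conjI allI impI)
      fix i assume i: "i \<notin> cells lv \<Delta>"
      then have "x i = 0" "y i = 0" using x y by (auto simp: tables_def arrays_def)
      then show "x i = v i" using yx[of i] zi(1)[of i] zi(4)[of i] by auto
    next
      fix i
      have "0 \<le> x i" "0 \<le> y i" using x y by (auto simp: tables_def)
      then show "v i \<le> x i" using yx[of i] zi(1)[of i] zi(4)[of i] by auto
    qed
    have "((\<lambda>i. v i + (x i - v i)), (\<lambda>i. u i + (x i - v i))) \<in> ?R\<^sup>*"
      using fiber_steps_translate[OF fiber_steps_rtrancl_sym[OF uv] w] .
    moreover have "(\<lambda>i. v i + (x i - v i)) = x" "(\<lambda>i. u i + (x i - v i)) = y"
      using yx zi(1) by auto
    ultimately show ?thesis by simp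
  qed
  have "(x, y) \<in> ?R\<^sup>*" if "(x, y) \<in> fiber_steps (tables \<Delta> lv) M" for x y
  proof -
    obtain z where z: "z \<in> M" "x \<in> tables \<Delta> lv" "y \<in> tables \<Delta> lv"
      "(\<forall>i. y i = x i + z i) \<or> (\<forall>i. y i = x i - z i)"
      using \<open>(x, y) \<in> fiber_steps (tables \<Delta> lv) M\<close> unfolding fiber_steps_def by blast
    from z(4) show ?thesis
    proof
      assume "\<forall>i. y i = x i + z i" then show ?thesis using plus z by blast
    next
      assume "\<forall>i. y i = x i - z i"
      then have "(y, x) \<in> ?R\<^sup>*" using plus[OF z(1,3,2)] by simp
      then show ?thesis by (rule fiber_steps_rtrancl_sym)
    qed
  qed
  then have "(fiber_steps (tables \<Delta> lv) M)\<^sup>* \<subseteq> ?R\<^sup>*"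
    by (meson rtrancl_subset_rtrancl subrelI)
  then show ?thesis using M N by (auto simp: markov_basis_iff)
qed

lemma fiber_stepsI:
  assumes "\<And>i. z i = u i - v i" "u \<in> F" "v \<in> F" "z \<in> N \<or> (\<lambda>i. - z i) \<in> N"
  shows "(u, v) \<in> fiber_steps F N"
  using assms(4)
proof
  assume "z \<in> N"
  then show ?thesis using assms(1-3) unfolding fiber_steps_def by (auto intro!: bexI[of _ z])
next
  assume "(\<lambda>i. - z i) \<in> N"
  then show ?thesis using assms(1-3) unfolding fiber_steps_def by (auto intro!: bexI[of _ "\<lambda>i. - z i"])
qed

lemma exists_minimal_markov_basis:
  assumes "markov_basis \<Delta> lv \<D> N"
  obtains M where "minimal_markov_basis \<Delta> lv \<D> M" "sign_classes M \<subseteq> sign_classes N"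
proof -
  let ?P = "\<lambda>M. markov_basis \<Delta> lv \<D> M \<and> sign_classes M \<subseteq> sign_classes N"
  have fin: "finite (sign_classes M)" if "?P M" for M
    using that by (auto simp: markov_basis_def sign_classes_def)
  define M where "M = arg_min (\<lambda>M. card (sign_classes M)) ?P"
  have M: "?P M" "\<And>M'. ?P M' \<Longrightarrow> card (sign_classes M) \<le> card (sign_classes M')"
    unfolding M_def using arg_min_nat_lemma[of ?P N "\<lambda>M. card (sign_classes M)"] assms by auto
  have "minimal_markov_basis \<Delta> lv \<D> M"
    unfolding minimal_markov_basis_def
  proof (intro conjI notI)
    show "markov_basis \<Delta> lv \<D> M" using M(1) by blast
    assume "\<exists>N. markov_basis \<Delta> lv \<D> N \<and> sign_classes N \<subset> sign_classes M"
    then obtain M' where M': "markov_basis \<Delta> lv \<D> M'" "sign_classes M' \<subset> sign_classes M" by blast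
    then have "card (sign_classes M') < card (sign_classes M)"
      using fin[OF M(1)] psubset_card_mono by blast
    then show False using M(2)[of M'] M' M(1) by auto
  qed
  then show ?thesis using that M by blast
qed

section \<open>Primitive moves\<close>

lemma primitive_moveE:
  assumes "z \<in> primitive_moves \<Delta> lv G"
  obtains i j k l where "{i, j, k, l} \<subseteq> cells lv \<Delta>" "distinct [i, j, k, l]"
    "z = (\<lambda>t. table_of {#i, j#} t - table_of {#k, l#} t)"
proof -
  obtain i j where ij: "{t \<in> cells lv \<Delta>. z t = 1} = {i, j}" "i \<noteq> j"
    using assms by (auto simp: primitive_moves_def card_2_iff)
  obtain k l where kl: "{t \<in> cells lv \<Delta>. z t = -1} = {k, l}" "k \<noteq> l"
    using assms by (auto simp: primitive_moves_def card_2_iff)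
  have mem: "t \<in> cells lv \<Delta> \<and> z t = 1 \<longleftrightarrow> t = i \<or> t = j"
    "t \<in> cells lv \<Delta> \<and> z t = -1 \<longleftrightarrow> t = k \<or> t = l" for t
    using ij(1) kl(1) by blast+
  have d: "distinct [i, j, k, l]"
    using mem[of i] mem[of j] ij(2) kl(2) by auto
  have "z t = table_of {#i, j#} t - table_of {#k, l#} t" for t
  proof (cases "t \<in> {i, j, k, l}")
    case True
    then show ?thesis using mem[of t] d by (auto simp: table_of_def)
  next
    case False
    then have "z t = 0"
      using mem[of t] assms by (cases "t \<in> cells lv \<Delta>") (auto simp: primitive_moves_def moves_def arrays_def)
    then show ?thesis using False by (auto simp: table_of_def)
  qed
  then have "z = (\<lambda>t. table_of {#i, j#} t - table_of {#k, l#} t)" by (intro ext)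
  moreover have "{i, j, k, l} \<subseteq> cells lv \<Delta>"
    using mem(1)[of i] mem(1)[of j] mem(2)[of k] mem(2)[of l] by simp
  ultimately show ?thesis using d by (intro that)
qed

lemma primitive_moveI:
  assumes "finite \<Delta>" "\<Union>G \<subseteq> \<Delta>" "{i, j, k, l} \<subseteq> cells lv \<Delta>" "distinct [i, j, k, l]"
    and "\<forall>D\<in>G. margin D {#i, j#} = margin D {#k, l#}"
  shows "(\<lambda>t. table_of {#i, j#} t - table_of {#k, l#} t) \<in> primitive_moves \<Delta> lv G" (is "?z \<in> _")
proof -
  have "{t \<in> cells lv \<Delta>. ?z t = 1} = {i, j}" "{t \<in> cells lv \<Delta>. ?z t = -1} = {k, l}"
    using assms(3,4) by (auto simp: table_of_def)
  moreover have "?z \<in> moves \<Delta> lv G"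
    using assms by (subst diff_moves_iff) auto
  ultimately show ?thesis
    using assms(4) by (auto simp: primitive_moves_def card_2_iff table_of_def)
qed

lemma primitive_moves_uminus:
  assumes "z \<in> primitive_moves \<Delta> lv G"
  shows "(\<lambda>i. - z i) \<in> primitive_moves \<Delta> lv G"
proof -
  have "{i \<in> cells lv \<Delta>. - z i = 1} = {i \<in> cells lv \<Delta>. z i = -1}"
    "{i \<in> cells lv \<Delta>. - z i = -1} = {i \<in> cells lv \<Delta>. z i = 1}" by auto
  then show ?thesis
    using assms moves_uminus by (fastforce simp: primitive_moves_def)
qed

lemma finite_primitive_moves:
  assumes "finite \<Delta>"
  shows "finite (primitive_moves \<Delta> lv G)"
proof -
  let ?A = "{z. \<forall>i. (i \<in> cells lv \<Delta> \<longrightarrow> z i \<in> {-1, 0, 1::int}) \<and> (i \<notin> cells lv \<Delta> \<longrightarrow> z i = 0)}"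
  have "finite ?A"
    by (rule finite_set_of_finite_funs[OF finite_cells[OF assms]]) simp
  moreover have "primitive_moves \<Delta> lv G \<subseteq> ?A"
    unfolding primitive_moves_def moves_def arrays_def by blast
  ultimately show ?thesis by (rule finite_subset[rotated])
qed

text \<open>Vanishing of a margin is inherited by all smaller margins, and being square-free of
  degree two does not depend on the model.\<close>

lemma primitive_moves_coarsen:
  assumes "finite \<Delta>" "\<Union>G \<subseteq> \<Delta>" "\<And>D. D \<in> \<D> \<Longrightarrow> \<exists>V\<in>G. D \<subseteq> V"
  shows "primitive_moves \<Delta> lv G \<subseteq> primitive_moves \<Delta> lv \<D>"
proof
  fix z assume z: "z \<in> primitive_moves \<Delta> lv G"
  then obtain i j k l where ijkl: "{i, j, k, l} \<subseteq> cells lv \<Delta>" "distinct [i, j, k, l]"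
    "z = (\<lambda>t. table_of {#i, j#} t - table_of {#k, l#} t)" by (rule primitive_moveE)
  have "z \<in> moves \<Delta> lv G" using z by (auto simp: primitive_moves_def)
  then have "\<forall>D\<in>G. margin D {#i, j#} = margin D {#k, l#}"
    unfolding ijkl(3) using ijkl(1) by (subst (asm) diff_moves_iff[OF assms(1,2)]) auto
  then have "margin D {#i, j#} = margin D {#k, l#}" if "D \<in> \<D>" for D
    using assms(3)[OF that] margin_mono by blast
  then have "\<forall>D\<in>\<D>. margin D {#i, j#} = margin D {#k, l#}" by blast
  moreover have "\<Union>\<D> \<subseteq> \<Delta>" using assms(2,3) by fast
  ultimately show "z \<in> primitive_moves \<Delta> lv \<D>"
    unfolding ijkl(3) by (intro primitive_moveI assms(1) ijkl(1,2))
qed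

section \<open>Swapping coordinates behind a separator\<close>

lemma override_on_cells:
  "i \<in> cells lv \<Delta> \<Longrightarrow> j \<in> cells lv \<Delta> \<Longrightarrow> override_on j i V \<in> cells lv \<Delta>"
  by (simp add: cells_def override_on_def PiE_iff extensional_def)

text \<open>Two cells that agree on the separator \<open>V \<inter> V'\<close> may exchange their
  coordinates outside \<open>V\<close>: on \<open>V\<close> and on \<open>V'\<close> the pair then
  shows the same two restrictions as before.\<close>

lemma swap_step:
  assumes fin: "finite \<Delta>" and V: "V \<union> V' = \<Delta>" and M: "primitive_moves \<Delta> lv {V, V'} \<subseteq> M"
    and ij: "i \<in> cells lv \<Delta>" "j \<in> cells lv \<Delta>" "restrict i (V \<inter> V') = restrict j (V \<inter> V')"
  defines "k \<equiv> override_on j i V" and "l \<equiv> override_on i j V"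
  shows "restrict k V = restrict i V" "restrict k V' = restrict j V'"
    "\<forall>D\<in>{V, V'}. margin D {#i, j#} = margin D {#k, l#}"
    "(table_of {#i, j#}, table_of {#k, l#}) \<in> (fiber_steps (tables \<Delta> lv) M)\<^sup>*"
proof -
  have eq: "\<delta> \<in> V \<Longrightarrow> \<delta> \<in> V' \<Longrightarrow> i \<delta> = j \<delta>" for \<delta>
    using fun_cong[OF ij(3), of \<delta>] by simp
  have r: "restrict k V = restrict i V" "restrict k V' = restrict j V'"
    "restrict l V = restrict j V" "restrict l V' = restrict i V'"
    using eq by (auto simp: k_def l_def override_on_def fun_eq_iff)
  then show "restrict k V = restrict i V" "restrict k V' = restrict j V'" by auto
  show m: "\<forall>D\<in>{V, V'}. margin D {#i, j#} = margin D {#k, l#}"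
    using r by (auto simp: add_mset_commute)
  have kl: "k \<in> cells lv \<Delta>" "l \<in> cells lv \<Delta>"
    using ij by (auto simp: k_def l_def intro: override_on_cells)
  have cell_eq: "x = y" if "x \<in> cells lv \<Delta>" "y \<in> cells lv \<Delta>" "restrict x V = restrict y V"
    "restrict x V' = restrict y V'" for x y
  proof
    fix \<delta>
    show "x \<delta> = y \<delta>"
      using that(1,2) fun_cong[OF that(3), of \<delta>] fun_cong[OF that(4), of \<delta>] V
      by (cases "\<delta> \<in> V"; cases "\<delta> \<in> V'") (auto simp: cells_def PiE_iff extensional_def)
  qed
  show "(table_of {#i, j#}, table_of {#k, l#}) \<in> (fiber_steps (tables \<Delta> lv) M)\<^sup>*"
  proof (cases "{#i, j#} = {#k, l#}")
    case True
    then show ?thesis by simp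
  next
    case False
    \<comment> \<open>Any coincidence among the four cells propagates until the two pairs are equal
      as multisets. A swap that changes the table is therefore a genuine primitive move.\<close>
    have imp: "i = k \<Longrightarrow> j = l" "j = k \<Longrightarrow> i = l" "i = l \<Longrightarrow> j = k" "j = l \<Longrightarrow> i = k"
      "i = j \<Longrightarrow> i = k" "k = l \<Longrightarrow> i = j"
      using r kl ij(1,2) by (auto intro: cell_eq)
    have n: "\<not> (i = k \<and> j = l)" "\<not> (i = l \<and> j = k)"
      using False by auto
    have ne: "i \<noteq> k" "j \<noteq> k" "i \<noteq> l" "j \<noteq> l"
      using imp(1-4) n by iprover+
    moreover have "i \<noteq> j" using imp(5) ne(1) by iprover
    moreover have "k \<noteq> l" using imp(6) \<open>i \<noteq> j\<close> by iprover
    ultimately have d: "distinct [i, j, k, l]" by simp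
    let ?z = "\<lambda>t. table_of {#i, j#} t - table_of {#k, l#} t"
    have "?z \<in> primitive_moves \<Delta> lv {V, V'}"
    proof (rule primitive_moveI[OF fin _ _ d m])
      show "\<Union>{V, V'} \<subseteq> \<Delta>" using V by simp
      show "{i, j, k, l} \<subseteq> cells lv \<Delta>" using ij kl by simp
    qed
    then have "?z \<in> M" using M by blast
    then have "(table_of {#i, j#}, table_of {#k, l#}) \<in> fiber_steps (tables \<Delta> lv) M"
      using ij(1,2) kl by (intro fiber_stepsI[where z = ?z]) simp_all
    then show ?thesis by auto
  qed
qed

text \<open>The cells of \<open>Y\<close> are matched one at a time: a swap produces in
  \<open>X\<close> a cell with the same restriction to \<open>V \<union> W\<close>, which is then
  set aside. Inside \<open>V'\<close>, swapping only permutes restrictions, so the margin on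
  \<open>W\<close> survives. Along a path of cliques, \<open>V\<close> is the part already treated
  and \<open>W\<close> the next clique.\<close>

lemma swap_reaches_union_margin:
  assumes fin: "finite \<Delta>" and V: "V \<union> V' = \<Delta>" and M: "primitive_moves \<Delta> lv {V, V'} \<subseteq> M"
    and W: "W \<subseteq> V'" "V \<inter> V' \<subseteq> W"
    and "set_mset X \<subseteq> cells lv \<Delta>" "set_mset Y \<subseteq> cells lv \<Delta>"
    and "margin V X = margin V Y" "margin W X = margin W Y"
  shows "\<exists>X'. (table_of X, table_of X') \<in> (fiber_steps (tables \<Delta> lv) M)\<^sup>* \<and>
    margin (V \<union> W) X' = margin (V \<union> W) Y"
  using assms(6-)
proof (induction Y arbitrary: X)
  case empty
  then have "X = {#}" by (metis margin_simps(1,4) size_eq_0_iff_empty)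
  then show ?case by auto
next
  case (add y Y)
  let ?R = "fiber_steps (tables \<Delta> lv) M"
  have "restrict y V \<in># margin V X" "restrict y W \<in># margin W X"
    using add.prems by auto
  then obtain i j where i: "i \<in># X" "restrict i V = restrict y V"
    and j: "j \<in># X" "restrict j W = restrict y W"
    by (auto simp: margin_def)
  \<comment> \<open>\<open>k\<close> is the cell matched with \<open>y\<close> and \<open>X1\<close>
    the remainder. If \<open>i\<close> itself agrees with \<open>y\<close> on \<open>W\<close>,
    nothing has to be swapped.\<close>
  have "\<exists>k X1. set_mset X1 \<subseteq> cells lv \<Delta> \<and> k \<in> cells lv \<Delta> \<and>
      (table_of X, table_of (add_mset k X1)) \<in> ?R\<^sup>* \<and>
      restrict k V = restrict y V \<and> restrict k W = restrict y W \<and>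
      margin V (add_mset k X1) = margin V X \<and> margin W (add_mset k X1) = margin W X"
  proof (cases "restrict i W = restrict y W")
    case True
    then show ?thesis
      using i add.prems(1)
      by (intro exI[of _ i] exI[of _ "X - {#i#}"]) (auto dest: in_diffD)
  next
    case False
    then have "i \<noteq> j" using j by auto
    then obtain X0 where X: "X = add_mset i (add_mset j X0)"
      using i j by (metis insert_DiffM insert_noteq_member)
    have ij: "i \<in> cells lv \<Delta>" "j \<in> cells lv \<Delta>" "set_mset X0 \<subseteq> cells lv \<Delta>"
      using add.prems(1) by (auto simp: X)
    \<comment> \<open>Both cells agree with \<open>y\<close> here: \<open>i\<close> because of
      \<open>V\<close>, and \<open>j\<close> because the separator lies in \<open>W\<close>.\<close>
    have "restrict i (V \<inter> V') = restrict j (V \<inter> V')"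
    proof
      fix \<delta>
      show "restrict i (V \<inter> V') \<delta> = restrict j (V \<inter> V') \<delta>"
        using fun_cong[OF i(2), of \<delta>] fun_cong[OF j(2), of \<delta>] W(2)
        by (cases "\<delta> \<in> W") auto
    qed
    note sw = swap_step[OF fin V M ij(1,2) this]
    let ?k = "override_on j i V" and ?l = "override_on i j V"
    have "(table_of X, table_of (add_mset ?k (add_mset ?l X0))) \<in> ?R\<^sup>*"
      using fiber_steps_translate[OF sw(4), of "table_of X0"] ij(3)
      by (simp add: X table_of_add[symmetric])
    moreover have "margin W {#i, j#} = margin W {#?k, ?l#}"
      using sw(3) W(1) margin_mono by (metis insertCI)
    moreover have "restrict ?k W = restrict y W"
      using sw(2) j(2) W(1) by (metis Int_absorb1 restrict_restrict)
    ultimately show ?thesis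
      using sw(1,3) i(2) ij override_on_cells
      by (intro exI[of _ ?k] exI[of _ "add_mset ?l X0"]) (auto simp: X add_mset_commute)
  qed
  then obtain k X1 where k: "set_mset X1 \<subseteq> cells lv \<Delta>" "k \<in> cells lv \<Delta>"
    "(table_of X, table_of (add_mset k X1)) \<in> ?R\<^sup>*"
    "restrict k V = restrict y V" "restrict k W = restrict y W"
    "margin V (add_mset k X1) = margin V X" "margin W (add_mset k X1) = margin W X"
    by blast
  have "margin V X1 = margin V Y" "margin W X1 = margin W Y"
    using k(6,7)[unfolded add.prems(3,4)] by (simp_all add: k(4,5))
  then obtain X' where X': "(table_of X1, table_of X') \<in> ?R\<^sup>*"
    "margin (V \<union> W) X' = margin (V \<union> W) Y"
    using add.IH[OF k(1)] add.prems(2) by auto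
  have "(table_of (add_mset k X1), table_of (add_mset k X')) \<in> ?R\<^sup>*"
    using fiber_steps_translate[OF X'(1), of "table_of {#k#}"] k(2)
    by (simp add: table_of_add[symmetric])
  moreover have "restrict k (V \<union> W) = restrict y (V \<union> W)"
  proof
    fix \<delta>
    show "restrict k (V \<union> W) \<delta> = restrict y (V \<union> W) \<delta>"
      using fun_cong[OF k(4), of \<delta>] fun_cong[OF k(5), of \<delta>]
      by (cases "\<delta> \<in> V"; cases "\<delta> \<in> W") auto
  qed
  ultimately show ?case
    using rtrancl_trans[OF k(3)] X'(2) by (intro exI[of _ "add_mset k X'"]) simp
qed

section \<open>Path graphs\<close>

definition path_edges :: "'a list \<Rightarrow> 'a set set" where
  "path_edges cs = {{cs ! k, cs ! Suc k} | k. Suc k < length cs}"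

lemma path_edge_iff:
  assumes "distinct cs" "a < length cs" "b < length cs"
  shows "{cs ! a, cs ! b} \<in> path_edges cs \<longleftrightarrow> b = Suc a \<or> a = Suc b"
proof
  assume "{cs ! a, cs ! b} \<in> path_edges cs"
  then obtain k where k: "Suc k < length cs" "{cs ! a, cs ! b} = {cs ! k, cs ! Suc k}"
    by (auto simp: path_edges_def)
  then have "cs ! a = cs ! k \<and> cs ! b = cs ! Suc k \<or> cs ! a = cs ! Suc k \<and> cs ! b = cs ! k"
    by (auto simp: doubleton_eq_iff)
  then show "b = Suc a \<or> a = Suc b"
    using assms k(1) by (auto simp: nth_eq_iff_index_eq)
next
  assume "b = Suc a \<or> a = Suc b"
  then show "{cs ! a, cs ! b} \<in> path_edges cs"
    using assms by (auto simp: path_edges_def insert_commute)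
qed

lemma is_path_rev: "is_path V E u p v \<Longrightarrow> is_path V E v (rev p) u"
  by (auto simp: is_path_def hd_rev last_rev successively_rev insert_commute)

lemma interval_is_path:
  assumes cs: "distinct cs" "set cs \<subseteq> V" and ij: "i \<le> j" "j < length cs"
    and e: "\<And>k. i \<le> k \<Longrightarrow> k < j \<Longrightarrow> {cs ! k, cs ! Suc k} \<in> E"
  shows "is_path V E (cs ! i) (map ((!) cs) [i..<Suc j]) (cs ! j)"
proof -
  have "successively (\<lambda>x y. {x, y} \<in> E) (map ((!) cs) [i..<Suc j])"
    using e ij by (auto simp: successively_conv_nth simp del: upt_Suc)
  moreover have "distinct (map ((!) cs) [i..<Suc j])"
    using cs(1) ij by (auto simp: distinct_map inj_on_def nth_eq_iff_index_eq simp del: upt_Suc)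
  moreover have "set (map ((!) cs) [i..<Suc j]) \<subseteq> V"
    using cs(2) ij by (auto simp del: upt_Suc)
  moreover have "hd (map ((!) cs) [i..<Suc j]) = cs ! i"
    using ij by (subst hd_map) (auto simp: hd_upt simp del: upt_Suc)
  ultimately show ?thesis
    using ij by (auto simp: is_path_def)
qed

lemma successively_closed:
  assumes "successively R p" "p \<noteq> []" "hd p \<in> S" "\<And>x y. x \<in> S \<Longrightarrow> R x y \<Longrightarrow> y \<in> S"
  shows "set p \<subseteq> S"
  using assms
proof (induction p)
  case (Cons a p)
  then show ?case by (cases p) auto
qed auto

lemma component_path_edges:
  assumes cs: "distinct cs" and k: "Suc k < length cs"
  defines "E \<equiv> path_edges cs - {{cs ! k, cs ! Suc k}}"
  shows "component (set cs) E (cs ! k) = (!) cs ` {..k}"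
    and "component (set cs) E (cs ! Suc k) = (!) cs ` {Suc k..<length cs}"
proof -
  have E_iff: "{cs ! a, cs ! b} \<in> E \<longleftrightarrow> (b = Suc a \<and> a \<noteq> k \<or> a = Suc b \<and> b \<noteq> k)"
    if "a < length cs" "b < length cs" for a b
  proof -
    have "{cs ! a, cs ! b} = {cs ! k, cs ! Suc k} \<longleftrightarrow> a = k \<and> b = Suc k \<or> a = Suc k \<and> b = k"
      using cs k that by (auto simp: doubleton_eq_iff nth_eq_iff_index_eq)
    then show ?thesis
      using path_edge_iff[OF cs that] by (auto simp: E_def)
  qed
  have E_ex: "\<exists>a b. a < length cs \<and> b < length cs \<and> x = cs ! a \<and> y = cs ! b" if "{x, y} \<in> E" for x y
    using that by (auto simp: E_def path_edges_def doubleton_eq_iff) (metis Suc_lessD)+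
  \<comment> \<open>An index set closed under adjacency in the cut path cannot be left by any path
    starting in it.\<close>
  have inv: "v \<in> (!) cs ` S"
    if p: "is_path (set cs) E (cs ! i) p v" and S: "i \<in> S" "S \<subseteq> {..<length cs}"
      "\<And>a b. a \<in> S \<Longrightarrow> b < length cs \<Longrightarrow> b = Suc a \<and> a \<noteq> k \<or> a = Suc b \<and> b \<noteq> k \<Longrightarrow> b \<in> S" for i v p S
  proof -
    have "set p \<subseteq> (!) cs ` S"
    proof (rule successively_closed)
      show "successively (\<lambda>x y. {x, y} \<in> E) p" "p \<noteq> []" "hd p \<in> (!) cs ` S"
        using p S by (auto simp: is_path_def)
      fix x y assume x: "x \<in> (!) cs ` S" and xy: "{x, y} \<in> E"
      then obtain a b where ab: "a \<in> S" "x = cs ! a" "b < length cs" "y = cs ! b"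
        using E_ex by blast
      then have "b \<in> S" using xy E_iff[of a b] S by blast
      then show "y \<in> (!) cs ` S" using ab by blast
    qed
    then show ?thesis using p by (auto simp: is_path_def)
  qed
  show "component (set cs) E (cs ! k) = (!) cs ` {..k}"
  proof
    show "component (set cs) E (cs ! k) \<subseteq> (!) cs ` {..k}"
      using k by (auto simp: component_def intro!: inv)
    show "(!) cs ` {..k} \<subseteq> component (set cs) E (cs ! k)"
    proof (clarify)
      fix i assume "i \<le> k"
      then have "is_path (set cs) E (cs ! i) (map ((!) cs) [i..<Suc k]) (cs ! k)"
        using k cs by (intro interval_is_path) (auto simp: E_iff)
      then show "cs ! i \<in> component (set cs) E (cs ! k)"
        by (auto simp: component_def dest: is_path_rev)
    qed
  qed
  show "component (set cs) E (cs ! Suc k) = (!) cs ` {Suc k..<length cs}"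
  proof
    show "component (set cs) E (cs ! Suc k) \<subseteq> (!) cs ` {Suc k..<length cs}"
      using k by (auto simp: component_def intro!: inv)
    show "(!) cs ` {Suc k..<length cs} \<subseteq> component (set cs) E (cs ! Suc k)"
    proof (clarify)
      fix i assume "i \<in> {Suc k..<length cs}"
      then have "is_path (set cs) E (cs ! Suc k) (map ((!) cs) [Suc k..<Suc i]) (cs ! i)"
        using k cs by (intro interval_is_path) (auto simp: E_iff)
      then show "cs ! i \<in> component (set cs) E (cs ! Suc k)"
        by (auto simp: component_def)
    qed
  qed
qed

text \<open>A walk on the integers with steps of size one can turn around only by revisiting the
  vertex it has just left.\<close>

lemma simple_path_monotone:
  fixes qs :: "nat list"
  assumes "successively (\<lambda>a b. b = Suc a \<or> a = Suc b) qs" "distinct qs"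
  shows "sorted_wrt (<) qs \<or> sorted_wrt (>) qs"
  using assms
proof (induction qs)
  case (Cons a qs)
  show ?case
  proof (cases qs)
    case Nil
    then show ?thesis by simp
  next
    case (Cons b rs)
    have b: "b = Suc a \<or> a = Suc b" using Cons.prems Cons by auto
    have IH: "sorted_wrt (<) qs \<or> sorted_wrt (>) qs" using Cons.IH Cons.prems Cons by auto
    show ?thesis
    proof (cases rs)
      case Nil
      then show ?thesis using b Cons by auto
    next
      case (Cons c ss)
      have c: "c = Suc b \<or> b = Suc c" "c \<noteq> a"
        using Cons.prems \<open>qs = b # rs\<close> Cons by auto
      show ?thesis
        using IH b c unfolding \<open>qs = b # rs\<close> Cons by fastforce
    qed
  qed
qed auto

lemma monotone_between:
  fixes qs :: "nat list"
  assumes "sorted_wrt (<) qs \<or> sorted_wrt (>) qs" "u \<in> set qs"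
  shows "min (hd qs) (last qs) \<le> u \<and> u \<le> max (hd qs) (last qs)"
proof -
  obtain xs ys where "qs = xs @ u # ys" using assms(2) by (meson split_list)
  then show ?thesis
    using assms(1) by (cases xs; cases ys rule: rev_cases) (auto simp: sorted_wrt_append)
qed

lemma index_function:
  obtains q where "\<And>x. x \<in> set cs \<Longrightarrow> q x < length cs \<and> cs ! q x = x"
proof -
  have "\<forall>x\<in>set cs. \<exists>k. k < length cs \<and> cs ! k = x"
    by (simp add: in_set_conv_nth)
  from bchoice[OF this] show ?thesis using that by blast
qed

lemma is_tree_path_edges:
  assumes cs: "distinct cs" "cs \<noteq> []"
  shows "is_tree (set cs) (path_edges cs)"
  unfolding is_tree_def
proof (intro conjI ballI notI)
  show "simple_graph (set cs) (path_edges cs)"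
    unfolding simple_graph_def
  proof
    fix e assume "e \<in> path_edges cs"
    then obtain k where "Suc k < length cs" "e = {cs ! k, cs ! Suc k}"
      by (auto simp: path_edges_def)
    moreover from this have "cs ! k \<noteq> cs ! Suc k"
      using cs by (simp add: nth_eq_iff_index_eq)
    ultimately show "\<exists>u\<in>set cs. \<exists>v\<in>set cs. u \<noteq> v \<and> e = {u, v}"
      by (metis Suc_lessD nth_mem)
  qed
  show "set cs = {} \<Longrightarrow> False" using cs by simp
next
  fix u v assume uv: "u \<in> set cs" "v \<in> set cs"
  then obtain i j where ij: "u = cs ! i" "i < length cs" "v = cs ! j" "j < length cs"
    by (metis in_set_conv_nth)
  have *: "\<exists>p. is_path (set cs) (path_edges cs) (cs ! i) p (cs ! j)"
    if "i \<le> j" "j < length cs" for i j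
  proof -
    have "{cs ! k, cs ! Suc k} \<in> path_edges cs" if "k < j" for k
      using \<open>j < length cs\<close> that by (simp add: path_edge_iff[OF cs(1)])
    then show ?thesis
      using interval_is_path[OF cs(1) subset_refl that] by blast
  qed
  show "\<exists>p. is_path (set cs) (path_edges cs) u p v"
    using *[of i j] *[of j i] ij(2,4) unfolding ij(1,3)
    by (cases "i \<le> j") (auto dest: is_path_rev)
next
  assume "\<exists>c. is_cycle (set cs) (path_edges cs) c"
  then obtain c where c: "3 \<le> length c" "distinct c" "set c \<subseteq> set cs" "cycle_edges c \<subseteq> path_edges cs"
    by (auto simp: is_cycle_def)
  let ?n = "length c"
  obtain q where q: "\<And>x. x \<in> set cs \<Longrightarrow> q x < length cs \<and> cs ! q x = x"
    using index_function[of cs] by blast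
  \<comment> \<open>Acyclicity by an extremal vertex: both cycle neighbours of the vertex with the
    largest index \<open>m\<close> would need the index \<open>m - 1\<close>.\<close>
  define m where "m = Max (q ` set c)"
  have "m \<in> q ` set c" unfolding m_def using c(1) by (intro Max_in) auto
  then obtain s where s: "s < ?n" "q (c ! s) = m" by (auto simp: in_set_conv_nth)
  have mem: "c ! t \<in> set cs" if "t < ?n" for t using that c(3) by auto
  have max: "q (c ! t) \<le> m" if "t < ?n" for t
    unfolding m_def using that by (intro Max_ge) auto
  \<comment> \<open>Cyclic successor and predecessor of \<open>s\<close>; the predecessor is written
    as adding \<open>?n - 1\<close>, to avoid truncated subtraction at 0.\<close>
  let ?s' = "Suc s mod ?n" and ?s'' = "(s + (?n - 1)) mod ?n"
  have lt: "?s' < ?n" "?s'' < ?n" using c(1) by (auto intro!: mod_less_divisor)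
  have "Suc ?s'' mod ?n = s"
  proof -
    have "Suc ?s'' mod ?n = Suc (s + (?n - 1)) mod ?n" by (rule mod_Suc_eq)
    also have "Suc (s + (?n - 1)) = s + ?n" using c(1) by simp
    finally show ?thesis using s(1) by simp
  qed
  then have "{c ! ?s'', c ! s} \<in> cycle_edges c" "{c ! s, c ! ?s'} \<in> cycle_edges c"
    using lt s unfolding cycle_edges_def by force+
  then have e: "{cs ! q (c ! ?s''), cs ! q (c ! s)} \<in> path_edges cs"
    "{cs ! q (c ! s), cs ! q (c ! ?s')} \<in> path_edges cs"
    using c(4) q[OF mem[OF lt(1)]] q[OF mem[OF lt(2)]] q[OF mem[OF s(1)]] by auto
  have ql: "q (c ! ?s') < length cs" "q (c ! ?s'') < length cs" "q (c ! s) < length cs"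
    using q mem lt s(1) by blast+
  have "q (c ! ?s'') = q (c ! ?s')"
    using e(1)[unfolded path_edge_iff[OF cs(1) ql(2,3)]] e(2)[unfolded path_edge_iff[OF cs(1) ql(3,1)]]
      max[OF lt(1)] max[OF lt(2)] s(2) by linarith
  then have "c ! ?s'' = c ! ?s'" using q mem lt by metis
  then have "?s'' = ?s'" using c(2) lt by (simp add: nth_eq_iff_index_eq)
  \<comment> \<open>In a cycle of length at least 3, predecessor and successor are different
    positions.\<close>
  moreover have "?s'' = (if s = 0 then ?n - 1 else s - 1)"
    using s(1) c(1) by (auto simp: mod_if)
  moreover have "?s' = (if Suc s = ?n then 0 else Suc s)"
    using s(1) by auto
  ultimately show False using c(1) s(1) by (auto split: if_splits)
qed

text \<open>A path between two cliques passes only through indices between theirs, so the clique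
  tree condition reduces to the interval property of the list.\<close>

lemma clique_tree_path_edges:
  assumes cs: "distinct cs" "cs \<noteq> []" and \<D>: "set cs = \<D>"
    and int: "\<And>i j k. i \<le> j \<Longrightarrow> j \<le> k \<Longrightarrow> k < length cs \<Longrightarrow> cs ! i \<inter> cs ! k \<subseteq> cs ! j"
  shows "clique_tree \<D> (path_edges cs)"
  unfolding clique_tree_def
proof (intro conjI ballI allI impI)
  show "is_tree \<D> (path_edges cs)" using is_tree_path_edges[OF cs] \<D> by simp
  fix Ds Dt p Du
  assume p: "is_path \<D> (path_edges cs) Ds p Dt" and u: "Du \<in> set p"
  obtain q where q: "\<And>x. x \<in> \<D> \<Longrightarrow> q x < length cs \<and> cs ! q x = x"
    using index_function[of cs] \<D> by blast
  have p': "p \<noteq> []" "hd p = Ds" "last p = Dt" "set p \<subseteq> \<D>" "distinct p"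
    "successively (\<lambda>x y. {x, y} \<in> path_edges cs) p"
    using p by (auto simp: is_path_def)
  have "successively (\<lambda>a b. b = Suc a \<or> a = Suc b) (map q p)"
    unfolding successively_map
  proof (rule successively_mono[OF p'(6)])
    fix x y assume xy: "x \<in> set p" "y \<in> set p" "{x, y} \<in> path_edges cs"
    then have "x \<in> \<D>" "y \<in> \<D>" using p'(4) by auto
    then show "q y = Suc (q x) \<or> q x = Suc (q y)"
      using path_edge_iff[OF cs(1), of "q x" "q y"] q[of x] q[of y] xy(3) by simp
  qed
  moreover have "distinct (map q p)"
    unfolding distinct_map
  proof (intro conjI inj_onI p'(5))
    fix x y assume "x \<in> set p" "y \<in> set p" "q x = q y"
    then show "x = y" using q[of x] q[of y] p'(4) by auto
  qed
  ultimately have "min (hd (map q p)) (last (map q p)) \<le> q Du \<and> q Du \<le> max (hd (map q p)) (last (map q p))"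
    using u by (intro monotone_between simple_path_monotone) auto
  then have b: "min (q Ds) (q Dt) \<le> q Du" "q Du \<le> max (q Ds) (q Dt)"
    using p' by (auto simp: hd_map last_map)
  have D: "Ds \<in> \<D>" "Dt \<in> \<D>" "Du \<in> \<D>" using p' u by auto
  show "Ds \<inter> Dt \<subseteq> Du"
    using int[of "q Ds" "q Du" "q Dt"] int[of "q Dt" "q Du" "q Ds"] b q D
    by (cases "q Ds \<le> q Dt") (auto simp: min_def max_def)
qed

section \<open>Chordal graphs without three independent vertices\<close>

lemma cycle_edges_image:
  "cycle_edges c = (\<lambda>i. {c ! i, c ! (Suc i mod length c)}) ` {..<length c}"
  by (auto simp: cycle_edges_def)

lemma chordal_cycle4:
  assumes "chordal V E" "simple_graph V E" "{a, b, c, d} \<subseteq> V" "distinct [a, b, c, d]"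
    and "{a, b} \<in> E" "{b, c} \<in> E" "{c, d} \<in> E" "{d, a} \<in> E"
  shows "{a, c} \<in> E \<or> {b, d} \<in> E"
proof -
  have ce: "cycle_edges [a, b, c, d] = {{a, b}, {b, c}, {c, d}, {d, a}}"
    by (auto simp: cycle_edges_image lessThan_Suc)
  have "is_cycle V E [a, b, c, d]"
    using assms(3-) by (simp add: is_cycle_def ce)
  then have "has_chord E [a, b, c, d]"
    using assms(1) unfolding chordal_def by fastforce
  then obtain u v where uv: "u \<in> set [a, b, c, d]" "v \<in> set [a, b, c, d]" "{u, v} \<in> E"
    "{u, v} \<notin> cycle_edges [a, b, c, d]"
    unfolding has_chord_def by blast
  \<comment> \<open>The two ends of a chord in \<open>has_chord\<close> are allowed to coincide;
    simplicity of the graph rules this out.\<close>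
  have "{x} \<notin> E" for x
    using assms(2) by (auto simp: simple_graph_def doubleton_eq_iff)
  note * = uv(3) uv(4)[unfolded ce] this
  from uv(1,2) show ?thesis
    unfolding list.set by (elim insertE emptyE; (use * in \<open>simp add: insert_commute\<close>))
qed

lemma chordal_cycle5:
  assumes "chordal V E" "simple_graph V E" "{a, b, c, d, e} \<subseteq> V" "distinct [a, b, c, d, e]"
    and "{a, b} \<in> E" "{b, c} \<in> E" "{c, d} \<in> E" "{d, e} \<in> E" "{e, a} \<in> E"
  shows "{a, c} \<in> E \<or> {a, d} \<in> E \<or> {b, d} \<in> E \<or> {b, e} \<in> E \<or> {c, e} \<in> E"
proof -
  have ce: "cycle_edges [a, b, c, d, e] = {{a, b}, {b, c}, {c, d}, {d, e}, {e, a}}"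
    by (auto simp: cycle_edges_image lessThan_Suc)
  have "is_cycle V E [a, b, c, d, e]"
    using assms(3-) by (simp add: is_cycle_def ce)
  then have "has_chord E [a, b, c, d, e]"
    using assms(1) unfolding chordal_def by fastforce
  then obtain u v where uv: "u \<in> set [a, b, c, d, e]" "v \<in> set [a, b, c, d, e]" "{u, v} \<in> E"
    "{u, v} \<notin> cycle_edges [a, b, c, d, e]"
    unfolding has_chord_def by blast
  have "{x} \<notin> E" for x
    using assms(2) by (auto simp: simple_graph_def doubleton_eq_iff)
  note * = uv(3) uv(4)[unfolded ce] this
  from uv(1,2) show ?thesis
    unfolding list.set by (elim insertE emptyE; (use * in \<open>simp add: insert_commute\<close>))
qed

text \<open>The non-neighbours of any vertex form a clique, since two nonadjacent ones would
  complete an independent triple. So it suffices to find a simplicial vertex \<open>b\<close>, one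
  whose closed neighbourhood \<open>N b\<close> is a clique. It is sought among the non-neighbours
  \<open>B\<close> of some vertex \<open>x\<close>.\<close>

lemma two_clique_cover:
  assumes fin: "finite V" and sg: "simple_graph V E" and ch: "chordal V E"
    and no3: "\<And>a b c. a \<in> V \<Longrightarrow> b \<in> V \<Longrightarrow> c \<in> V \<Longrightarrow> distinct [a, b, c] \<Longrightarrow>
      {a, b} \<in> E \<or> {a, c} \<in> E \<or> {b, c} \<in> E"
  obtains A B where "V = A \<union> B" "clique A E" "clique B E"
proof (cases "clique V E")
  case True
  then show ?thesis using that[of V "{}"] by (simp add: clique_def)
next
  case False
  then obtain x y where xy: "x \<in> V" "y \<in> V" "x \<noteq> y" "{x, y} \<notin> E"
    by (auto simp: clique_def)
  have sym: "{u, v} \<in> E \<longleftrightarrow> {v, u} \<in> E" for u v by (simp add: insert_commute)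
  have cc: "{u, w} \<in> E \<or> {v, t} \<in> E"
    if "{u, v, w, t} \<subseteq> V" "distinct [u, v, w, t]" "{u, v} \<in> E" "{v, w} \<in> E" "{w, t} \<in> E" "{t, u} \<in> E"
    for u v w t using chordal_cycle4[OF ch sg that] .
  define N where "N v = {w \<in> V. w = v \<or> {v, w} \<in> E}" for v
  have co_clique: "clique (V - N v) E" if "v \<in> V" for v
    unfolding clique_def
  proof (intro ballI impI)
    fix a b assume "a \<in> V - N v" "b \<in> V - N v" "a \<noteq> b"
    then show "{a, b} \<in> E" using no3[of v a b] that by (auto simp: N_def)
  qed
  define B where "B = V - N x"
  have B: "clique B E" "y \<in> B" "B \<subseteq> V"
    using co_clique[OF xy(1)] xy by (auto simp: B_def N_def)
  have xB: "{x, b} \<notin> E" "b \<noteq> x" if "b \<in> B" for b using that by (auto simp: B_def N_def)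
  \<comment> \<open>\<open>S\<close> is the boundary between \<open>x\<close> and \<open>B\<close>:
    every neighbour of a vertex of \<open>B\<close> outside \<open>B\<close> belongs to it.\<close>
  define S where "S = {s \<in> V. {x, s} \<in> E \<and> (\<exists>b\<in>B. {s, b} \<in> E)}"
  have SB: "s \<notin> B" "s \<noteq> x" if "s \<in> S" for s
    using that sg by (auto simp: S_def B_def N_def simple_graph_def doubleton_eq_iff)
  have S: "{s, t} \<in> E" if st: "s \<in> S" "t \<in> S" "s \<noteq> t" for s t
  proof (rule ccontr)
    assume nst: "{s, t} \<notin> E"
    obtain b b' where b: "b \<in> B" "{s, b} \<in> E" and b': "b' \<in> B" "{t, b'} \<in> E"
      using st by (auto simp: S_def)
    have xs: "{x, s} \<in> E" "{x, t} \<in> E" "s \<in> V" "t \<in> V" using st by (auto simp: S_def)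
    \<comment> \<open>A common neighbour in \<open>B\<close> would close the chordless 4-cycle
      \<open>s, c, t, x\<close>.\<close>
    have no_common: "\<not> ({s, c} \<in> E \<and> {t, c} \<in> E)" if c: "c \<in> B" for c
    proof
      assume h: "{s, c} \<in> E \<and> {t, c} \<in> E"
      have "{s, t} \<in> E \<or> {c, x} \<in> E"
      proof (rule cc)
        show "{s, c, t, x} \<subseteq> V" using xs xy(1) c B(3) by auto
        show "distinct [s, c, t, x]" using SB[OF st(1)] SB[OF st(2)] xB[OF c] c st(3) by auto
      qed (use h xs sym in blast)+
      then show False using nst xB(1)[OF c] sym by blast
    qed
    have "b \<noteq> b'" using no_common[OF b(1)] b b' by blast
    have nb: "{s, b'} \<notin> E" "{t, b} \<notin> E" using no_common[OF b(1)] no_common[OF b'(1)] b b' by blast+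
    \<comment> \<open>With distinct neighbours \<open>b\<close> and \<open>b'\<close>, the cycle
      \<open>s, b, b', t, x\<close> would be a chordless 5-cycle.\<close>
    have "{s, b'} \<in> E \<or> {s, t} \<in> E \<or> {b, t} \<in> E \<or> {b, x} \<in> E \<or> {b', x} \<in> E"
    proof (rule chordal_cycle5[OF ch sg])
      show "{s, b, b', t, x} \<subseteq> V" using xs xy(1) b b' B(3) by auto
      show "distinct [s, b, b', t, x]"
        using SB[OF st(1)] SB[OF st(2)] xB[OF b(1)] xB[OF b'(1)] b b' st(3) \<open>b \<noteq> b'\<close> by auto
      show "{b, b'} \<in> E" using B(1) b b' \<open>b \<noteq> b'\<close> by (simp add: clique_def)
    qed (use b b' xs sym in blast)+
    then show False using nb nst xB(1)[OF b(1)] xB(1)[OF b'(1)] sym by blast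
  qed
  have finS: "finite S" using fin by (auto simp: S_def)
  \<comment> \<open>Fewest neighbours in \<open>S\<close>: this choice forces those neighbours to be
    adjacent to all of \<open>B\<close>, which makes \<open>N b\<close> a clique.\<close>
  define b where "b = arg_min (\<lambda>b. card (S \<inter> N b)) (\<lambda>b. b \<in> B)"
  have b: "b \<in> B" and b_min: "\<And>c. c \<in> B \<Longrightarrow> card (S \<inter> N b) \<le> card (S \<inter> N c)"
    unfolding b_def
    using arg_min_nat_lemma[of "\<lambda>b. b \<in> B" y "\<lambda>b. card (S \<inter> N b)"] B(2) by auto
  \<comment> \<open>If \<open>c\<close> misses the neighbour \<open>s\<close> of \<open>b\<close>,
    minimality gives \<open>c\<close> a neighbour \<open>t\<close> in \<open>S\<close> that
    \<open>b\<close> misses. As \<open>S\<close> and \<open>B\<close> are cliques,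
    \<open>s, b, c, t\<close> is then a chordless 4-cycle.\<close>
  have nested: "{s, c} \<in> E" if s: "s \<in> S" "s \<in> N b" and c: "c \<in> B" for s c
  proof (rule ccontr)
    assume nsc: "{s, c} \<notin> E"
    have sb: "s \<noteq> b" "s \<noteq> c" using SB[OF s(1)] b c by auto
    have sbE: "{s, b} \<in> E" using s(2) sb sym by (auto simp: N_def)
    have "s \<notin> N c" using nsc sb sym by (auto simp: N_def)
    then have "\<not> S \<inter> N c \<subseteq> S \<inter> N b"
      using b_min[OF c] card_mono[of "S \<inter> N b" "S \<inter> N c"] s finS
        psubset_card_mono[of "S \<inter> N b" "S \<inter> N c"] by auto
    then obtain t where t: "t \<in> S" "t \<in> N c" "t \<notin> N b" by blast
    have tn: "t \<in> V" "t \<noteq> b" "t \<noteq> c" using SB[OF t(1)] b c t by (auto simp: S_def)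
    have tE: "{t, c} \<in> E" "{t, b} \<notin> E" using t tn sym by (auto simp: N_def)
    have ne: "s \<noteq> t" "b \<noteq> c" using tE nsc sbE by auto
    have "{s, c} \<in> E \<or> {b, t} \<in> E"
    proof (rule cc)
      show "{s, b, c, t} \<subseteq> V" using s tn b c B(3) by (auto simp: S_def)
      show "distinct [s, b, c, t]" using sb tn ne by auto
      show "{b, c} \<in> E" using B(1) b c ne by (simp add: clique_def)
      show "{t, s} \<in> E" using S s t ne by blast
    qed (use sbE tE sym in blast)+
    then show False using nsc tE sym by blast
  qed
  have bV: "b \<in> V" using b B by auto
  have split: "w \<in> B \<or> w \<in> S \<and> w \<in> N b" if w: "w \<in> N b" for w
  proof (cases "w \<in> B")
    case False
    then have "{x, w} \<in> E \<or> w = x" using w by (auto simp: B_def N_def)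
    moreover have "w \<noteq> b" using False b by auto
    moreover from this have "{b, w} \<in> E" "w \<in> V" using w by (auto simp: N_def)
    ultimately show ?thesis using w b xB(1)[OF b] sym unfolding S_def by blast
  qed simp
  have "clique (N b) E"
    unfolding clique_def
  proof (intro ballI impI)
    fix v w assume "v \<in> N b" "w \<in> N b" "v \<noteq> w"
    then show "{v, w} \<in> E"
      using split[of v] split[of w] S nested sym B(1) unfolding clique_def by blast
  qed
  moreover have "V = N b \<union> (V - N b)" by (auto simp: N_def)
  ultimately show ?thesis using that co_clique[OF bV] by blast
qed

lemma cliqueD: "clique C E \<Longrightarrow> u \<in> C \<Longrightarrow> v \<in> C \<Longrightarrow> u \<noteq> v \<Longrightarrow> {u, v} \<in> E"
  by (simp add: clique_def)

lemma maximal_cliqueD: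
  assumes "D \<in> maximal_cliques V E" "v \<in> V" "\<And>w. w \<in> D \<Longrightarrow> w \<noteq> v \<Longrightarrow> {v, w} \<in> E"
  shows "v \<in> D"
proof (rule ccontr)
  assume "v \<notin> D"
  then have "D \<subset> insert v D" by blast
  moreover have "insert v D \<subseteq> V" using assms(1,2) by (auto simp: maximal_cliques_def)
  moreover have "clique (insert v D) E"
    using assms by (auto simp: maximal_cliques_def clique_def insert_commute)
  ultimately show False using assms(1) by (auto simp: maximal_cliques_def)
qed

text \<open>The maximal cliques are ordered by their traces on \<open>B\<close>; the traces on \<open>A\<close> then decrease.\<close>

lemma clique_order:
  assumes fin: "finite V" and sg: "simple_graph V E" and ch: "chordal V E"
    and V: "V = A \<union> B" and A: "clique A E" and B: "clique B E"
  obtains cs where "distinct cs" "set cs = maximal_cliques V E"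
    "\<And>i j k. i \<le> j \<Longrightarrow> j \<le> k \<Longrightarrow> k < length cs \<Longrightarrow> cs ! i \<inter> cs ! k \<subseteq> cs ! j"
proof -
  let ?\<D> = "maximal_cliques V E" and ?f = "\<lambda>D. card (D \<inter> B)"
  have sym: "{u, v} \<in> E \<longleftrightarrow> {v, u} \<in> E" for u v by (simp add: insert_commute)
  have D: "D \<subseteq> V" "\<And>u v. u \<in> D \<Longrightarrow> v \<in> D \<Longrightarrow> u \<noteq> v \<Longrightarrow> {u, v} \<in> E" if "D \<in> ?\<D>" for D
    using that by (auto simp: maximal_cliques_def clique_def)
  \<comment> \<open>By maximality, \<open>b\<close> has a non-neighbour in \<open>D'\<close>; it
    cannot lie in the clique \<open>B\<close>.\<close>
  have sep: "\<exists>v\<in>D'. v \<in> A \<and> v \<noteq> b \<and> {b, v} \<notin> E"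
    if "D' \<in> ?\<D>" "b \<in> B" "b \<notin> D'" for D' b
  proof (rule ccontr)
    assume n: "\<not> ?thesis"
    have "b \<in> D'"
    proof (rule maximal_cliqueD[OF that(1)])
      show "b \<in> V" using that(2) V by blast
      fix w assume w: "w \<in> D'" "w \<noteq> b"
      then have "w \<in> A \<or> w \<in> B" using D(1)[OF that(1)] V by blast
      then show "{b, w} \<in> E"
        using n w cliqueD[OF B that(2), of w] by auto
    qed
    then show False using that(3) by blast
  qed
  \<comment> \<open>Incomparable traces give \<open>b\<close>, \<open>b'\<close> in \<open>B\<close>
    and non-neighbours \<open>v\<close>, \<open>w\<close> of them in \<open>A\<close>, which form
    the chordless 4-cycle \<open>v, b', b, w\<close>.\<close>
  have chain: "D \<inter> B \<subseteq> D' \<inter> B \<or> D' \<inter> B \<subseteq> D \<inter> B" if DD: "D \<in> ?\<D>" "D' \<in> ?\<D>" for D D'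
  proof (rule ccontr)
    assume "\<not> ?thesis"
    then obtain b b' where b: "b \<in> D" "b \<in> B" "b \<notin> D'" and b': "b' \<in> D'" "b' \<in> B" "b' \<notin> D"
      by blast
    obtain v where v: "v \<in> D'" "v \<in> A" "v \<noteq> b" "{b, v} \<notin> E" using sep[OF DD(2) b(2,3)] by blast
    obtain w where w: "w \<in> D" "w \<in> A" "w \<noteq> b'" "{b', w} \<notin> E" using sep[OF DD(1) b'(2,3)] by blast
    have ne: "b \<noteq> b'" "v \<noteq> b'" "w \<noteq> b" "v \<noteq> w"
      using b b' v w D(2)[OF DD(1) b(1)] cliqueD[OF B b(2) b'(2)] cliqueD[OF B b'(2) b(2)] by auto
    have "{v, b} \<in> E \<or> {b', w} \<in> E"
    proof (rule chordal_cycle4[OF ch sg])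
      show "{v, b', b, w} \<subseteq> V" using v w b b' V by auto
      show "distinct [v, b', b, w]" using ne v w by auto
      show "{v, b'} \<in> E" using D(2)[OF DD(2) v(1) b'(1) ne(2)] .
      show "{b', b} \<in> E" using cliqueD[OF B b'(2) b(2)] ne(1) by blast
      show "{b, w} \<in> E" using D(2)[OF DD(1) b(1) w(1)] ne(3) by blast
      show "{w, v} \<in> E" using cliqueD[OF A w(2) v(2)] ne(4) by blast
    qed
    then show False using v w sym by blast
  qed
  have finB: "finite B" using fin V by auto
  \<comment> \<open>Once \<open>D \<inter> B\<close> lies in \<open>D'\<close>, a vertex of
    \<open>D' \<inter> A\<close> is adjacent to all other vertices of \<open>D\<close>: to those in
    \<open>A\<close> because \<open>A\<close> is a clique, to those in \<open>B\<close> because they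
    belong to \<open>D'\<close>. Maximality puts it into \<open>D\<close>.\<close>
  have le: "D \<inter> B \<subseteq> D' \<and> D' \<inter> A \<subseteq> D" if DD: "D \<in> ?\<D>" "D' \<in> ?\<D>" "?f D \<le> ?f D'" for D D'
  proof -
    have s: "D \<inter> B \<subseteq> D'"
      using chain[OF DD(1,2)] DD(3) card_seteq[of "D \<inter> B" "D' \<inter> B"] finB by auto
    have "v \<in> D" if v: "v \<in> D'" "v \<in> A" for v
    proof (rule maximal_cliqueD[OF DD(1)])
      show "v \<in> V" using v V by auto
      fix w assume w: "w \<in> D" "w \<noteq> v"
      then have "w \<in> A \<or> w \<in> D'" using s D(1)[OF DD(1)] V by blast
      then show "{v, w} \<in> E"
        using w cliqueD[OF A v(2), of w] D(2)[OF DD(2) v(1), of w] by auto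
    qed
    then show ?thesis using s by blast
  qed
  have "finite ?\<D>"
    by (rule finite_subset[of _ "Pow V"]) (use fin in \<open>auto simp: maximal_cliques_def\<close>)
  then obtain xs where xs: "set xs = ?\<D>" "distinct xs" using finite_distinct_list by blast
  \<comment> \<open>The traces on \<open>B\<close> form a chain, so sorting by their size sorts them
    by inclusion.\<close>
  define cs where "cs = sort_key ?f xs"
  have cs: "distinct cs" "set cs = ?\<D>" and sorted: "sorted (map ?f cs)"
    using xs by (auto simp: cs_def)
  show ?thesis
  proof (rule that[OF cs])
    fix i j k assume ijk: "i \<le> j" "j \<le> k" "k < length cs"
    have "cs ! i \<in> ?\<D>" "cs ! j \<in> ?\<D>" "cs ! k \<in> ?\<D>"
      using ijk cs(2) nth_mem[of _ cs] by auto
    moreover have "?f (cs ! i) \<le> ?f (cs ! j)" "?f (cs ! j) \<le> ?f (cs ! k)"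
      using sorted_nth_mono[OF sorted, of i j] sorted_nth_mono[OF sorted, of j k] ijk by auto
    ultimately have "cs ! i \<inter> B \<subseteq> cs ! j" "cs ! k \<inter> A \<subseteq> cs ! j" "cs ! i \<subseteq> V"
      using le D(1) by blast+
    \<comment> \<open>A common vertex in \<open>B\<close> is handed on from the left neighbour in
      the order, one in \<open>A\<close> from the right.\<close>
    then show "cs ! i \<inter> cs ! k \<subseteq> cs ! j" using V by blast
  qed
qed

lemma simple_graph_independence_edges:
  "\<Union>\<D> \<subseteq> V \<Longrightarrow> simple_graph V (independence_edges \<D>)"
  unfolding simple_graph_def independence_edges_def by blast

section \<open>The primitive moves of a path of cliques\<close>

context
  fixes \<Delta> :: "'v set" and lv :: "'v \<Rightarrow> nat" and \<D> :: "'v set set" and cs :: "'v set list"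
  assumes fin: "finite \<Delta>" and un: "\<Union>\<D> = \<Delta>"
    and cs: "distinct cs" "cs \<noteq> []" "set cs = \<D>"
    and int: "\<And>i j k. i \<le> j \<Longrightarrow> j \<le> k \<Longrightarrow> k < length cs \<Longrightarrow> cs ! i \<inter> cs ! k \<subseteq> cs ! j"
begin

lemma edge_generating_class_path:
  assumes "Suc k < length cs"
  shows "edge_generating_class \<D> (path_edges cs) {cs ! k, cs ! Suc k} =
    {\<Union>((!) cs ` {..k}), \<Union>((!) cs ` {Suc k..<length cs})}"
  using component_path_edges[OF cs(1) assms] unfolding edge_generating_class_def cs(3) by simp

lemma path_edge_moves_subset:
  assumes "Suc k < length cs"
  shows "primitive_moves \<Delta> lv {\<Union>((!) cs ` {..k}), \<Union>((!) cs ` {Suc k..<length cs})}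
    \<subseteq> clique_tree_moves \<Delta> lv \<D> (path_edges cs)"
proof -
  have "{cs ! k, cs ! Suc k} \<in> path_edges cs" using assms by (auto simp: path_edges_def)
  then show ?thesis
    unfolding clique_tree_moves_def edge_generating_class_path[OF assms, symmetric] by blast
qed

lemma nth_subset: "k < length cs \<Longrightarrow> cs ! k \<subseteq> \<Delta>"
  using un cs(3) nth_mem by blast

text \<open>Every clique lies entirely on one side of a deleted edge, so the two-set model of that
  edge is coarser than the clique model.\<close>

lemma clique_tree_moves_path_primitive:
  "clique_tree_moves \<Delta> lv \<D> (path_edges cs) \<subseteq> primitive_moves \<Delta> lv \<D>"
proof -
  have "primitive_moves \<Delta> lv (edge_generating_class \<D> (path_edges cs) e) \<subseteq> primitive_moves \<Delta> lv \<D>"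
    if "e \<in> path_edges cs" for e
  proof -
    obtain k where k: "Suc k < length cs" "e = {cs ! k, cs ! Suc k}"
      using \<open>e \<in> path_edges cs\<close> by (auto simp: path_edges_def)
    let ?L = "\<Union>((!) cs ` {..k})" and ?R = "\<Union>((!) cs ` {Suc k..<length cs})"
    show ?thesis
      unfolding k(2) edge_generating_class_path[OF k(1)]
    proof (rule primitive_moves_coarsen[OF fin])
      have "?L \<subseteq> \<Delta>" "?R \<subseteq> \<Delta>" by (rule UN_least, rule nth_subset, use k(1) in simp)+
      then show "\<Union>{?L, ?R} \<subseteq> \<Delta>" by blast
      fix D assume "D \<in> \<D>"
      then obtain i where i: "i < length cs" "D = cs ! i"
        unfolding cs(3)[symmetric] in_set_conv_nth by blast
      then have "D \<subseteq> ?L \<or> D \<subseteq> ?R" by (cases "i \<le> k") auto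
      then show "\<exists>V\<in>{?L, ?R}. D \<subseteq> V" by blast
    qed
  qed
  then show ?thesis unfolding clique_tree_moves_def by blast
qed

text \<open>The invariant is agreement with \<open>Y\<close> on the union of the cliques up to index
  \<open>k\<close>. To pass to the next clique, cells are swapped at the edge leading to it; the
  margin of that clique is still correct, because all earlier moves preserve every clique
  margin.\<close>

lemma markov_basis_clique_tree_moves_path:
  "markov_basis \<Delta> lv \<D> (clique_tree_moves \<Delta> lv \<D> (path_edges cs))"
proof -
  let ?M = "clique_tree_moves \<Delta> lv \<D> (path_edges cs)"
  let ?R = "fiber_steps (tables \<Delta> lv) ?M"
  have finM: "finite ?M"
    using clique_tree_moves_path_primitive finite_primitive_moves[OF fin] by (rule finite_subset)
  have M: "?M \<subseteq> moves \<Delta> lv \<D>"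
    using clique_tree_moves_path_primitive by (auto simp: primitive_moves_def)
  have un': "\<Union>\<D> \<subseteq> \<Delta>" using un by simp
  have "(table_of X, table_of Y) \<in> ?R\<^sup>*"
    if X: "set_mset X \<subseteq> cells lv \<Delta>" and Y: "set_mset Y \<subseteq> cells lv \<Delta>"
      and XY: "\<forall>D\<in>\<D>. margin D X = margin D Y" for X Y
  proof -
    let ?L = "\<lambda>k. \<Union>((!) cs ` {..k})"
    have "\<exists>X'. (table_of X, table_of X') \<in> ?R\<^sup>* \<and> margin (?L k) X' = margin (?L k) Y"
      if "k < length cs" for k
      using that
    proof (induction k)
      case 0
      then have "cs ! 0 \<in> \<D>" using cs(3) nth_mem by blast
      then show ?case using XY by (intro exI[of _ X]) auto
    next
      case (Suc k)
      then obtain X' where X': "(table_of X, table_of X') \<in> ?R\<^sup>*" "margin (?L k) X' = margin (?L k) Y"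
        by auto
      have X'c: "set_mset X' \<subseteq> cells lv \<Delta>"
        using table_steps_rtrancl_tables[OF X'(1)] X by simp
      have "\<forall>D\<in>\<D>. margin D X = margin D X'"
        using table_steps_rtrancl_marginal_freqs[OF M X'(1)]
        unfolding marginal_freqs_table_of[OF fin un' X X'c] .
      moreover have "cs ! Suc k \<in> \<D>" using cs(3) Suc.prems nth_mem by blast
      ultimately have m: "margin (cs ! Suc k) X' = margin (cs ! Suc k) Y"
        using XY by metis
      let ?V' = "\<Union>((!) cs ` {Suc k..<length cs})"
      have VV: "?L k \<union> ?V' = \<Delta>"
      proof
        show "?L k \<union> ?V' \<subseteq> \<Delta>" 
          by (intro Un_least UN_least nth_subset) (use Suc.prems in simp_all)
        show "\<Delta> \<subseteq> ?L k \<union> ?V'"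
        proof
          fix x assume "x \<in> \<Delta>"
          then obtain i where "i < length cs" "x \<in> cs ! i"
            unfolding un[symmetric] cs(3)[symmetric] by (auto simp: in_set_conv_nth)
          then show "x \<in> ?L k \<union> ?V'" by (cases "i \<le> k") auto
        qed
      qed
      \<comment> \<open>By the interval property, whatever is shared by both sides of the edge
        passes through the next clique.\<close>
      have sep: "?L k \<inter> ?V' \<subseteq> cs ! Suc k"
      proof
        fix x assume "x \<in> ?L k \<inter> ?V'"
        then obtain i j where "i \<le> k" "x \<in> cs ! i" "Suc k \<le> j" "j < length cs" "x \<in> cs ! j" by auto
        then show "x \<in> cs ! Suc k" using int[of i "Suc k" j] by auto
      qed
      have W: "cs ! Suc k \<subseteq> ?V'" using Suc.prems by auto
      obtain X'' where X'': "(table_of X', table_of X'') \<in> ?R\<^sup>*"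
        "margin (?L k \<union> cs ! Suc k) X'' = margin (?L k \<union> cs ! Suc k) Y"
        using swap_reaches_union_margin[OF fin VV path_edge_moves_subset[OF Suc.prems] W sep X'c Y X'(2) m]
        by blast
      have "?L (Suc k) = ?L k \<union> cs ! Suc k" by (auto simp: atMost_Suc)
      then show ?case using X'' rtrancl_trans[OF X'(1) X''(1)] by metis
    qed
    moreover have "length cs - 1 < length cs" using cs(2) by simp
    ultimately obtain X' where X': "(table_of X, table_of X') \<in> ?R\<^sup>*"
      "margin (?L (length cs - 1)) X' = margin (?L (length cs - 1)) Y" by blast
    \<comment> \<open>At the last index the union is all of \<Delta>, and the margin there is the
      table itself.\<close>
    have "{..length cs - 1} = {0..<length cs}" using cs(2) by (cases cs) auto
    then have "?L (length cs - 1) = \<Delta>" using un cs(3) by (simp add: nth_image)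
    moreover have "set_mset X' \<subseteq> cells lv \<Delta>"
      using table_steps_rtrancl_tables[OF X'(1)] X by simp
    ultimately have "X' = Y" using X'(2) margin_same Y by metis
    then show ?thesis using X'(1) by simp
  qed
  then have "(x, y) \<in> ?R\<^sup>*"
    if "x \<in> tables \<Delta> lv" "y \<in> tables \<Delta> lv" "marginal_freqs \<Delta> lv \<D> x = marginal_freqs \<Delta> lv \<D> y" for x y
    using that by (elim tableE[OF fin]) (simp add: marginal_freqs_table_of[OF fin un'])
  then show ?thesis using finM M unfolding markov_basis_iff by blast
qed

end

section \<open>Fibers of degree two\<close>

lemma mset_pair_eq_iff:
  "{#a, b#} = {#c, d#} \<longleftrightarrow> a = c \<and> b = d \<or> a = d \<and> b = c"
  by (auto simp: add_eq_conv_ex)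

lemma cells_ext:
  "x \<in> cells lv \<Delta> \<Longrightarrow> y \<in> cells lv \<Delta> \<Longrightarrow> (\<And>\<delta>. \<delta> \<in> \<Delta> \<Longrightarrow> x \<delta> = y \<delta>) \<Longrightarrow> x = y"
  unfolding cells_def by (rule PiE_ext)

text \<open>Fix a coordinate \<open>\<delta>0\<close> where \<open>i\<close> and \<open>j\<close>
  differ and order each pair so that \<open>\<delta>0\<close> is not exchanged. An exchanged
  coordinate is then nonadjacent to \<open>\<delta>0\<close>. Two different nontrivial exchange
  patterns would yield a second and a third coordinate that are also nonadjacent to each other,
  hence an independent triple.\<close>

lemma degree_two_fiber_le_two:
  assumes un: "\<Union>\<D> = \<Delta>" and c: "{i, j, k, l, m, n} \<subseteq> cells lv \<Delta>"
    and kl: "\<forall>D\<in>\<D>. margin D {#k, l#} = margin D {#i, j#}"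
    and mn: "\<forall>D\<in>\<D>. margin D {#m, n#} = margin D {#i, j#}"
    and no3: "\<And>a b c. a \<in> \<Delta> \<Longrightarrow> b \<in> \<Delta> \<Longrightarrow> c \<in> \<Delta> \<Longrightarrow> distinct [a, b, c] \<Longrightarrow>
      \<exists>D\<in>\<D>. {a, b} \<subseteq> D \<or> {a, c} \<subseteq> D \<or> {b, c} \<subseteq> D"
  shows "{#k, l#} = {#i, j#} \<or> {#m, n#} = {#i, j#} \<or> {#k, l#} = {#m, n#}"
proof (cases "i = j")
  case True
  have "k = i \<and> l = j"
  proof -
    have "k \<delta> = i \<delta> \<and> l \<delta> = j \<delta>" if "\<delta> \<in> \<Delta>" for \<delta>
    proof -
      obtain D where D: "D \<in> \<D>" "\<delta> \<in> D" using \<open>\<delta> \<in> \<Delta>\<close> un by blast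
      then have "restrict k D = restrict i D \<and> restrict l D = restrict j D"
        using kl True by (auto simp: mset_pair_eq_iff)
      then show ?thesis using D(2) by (metis restrict_apply')
    qed
    then show ?thesis using c by (auto intro!: cells_ext[of _ lv \<Delta>])
  qed
  then show ?thesis by simp
next
  case False
  then obtain \<delta>0 where d0: "\<delta>0 \<in> \<Delta>" "i \<delta>0 \<noteq> j \<delta>0"
    using c cells_ext[of i lv \<Delta> j] by auto
  \<comment> \<open>\<open>flip k l\<close> fixes the order of the pair by the value at
    \<open>\<delta>0\<close> and records that the coordinates of a clique are exchanged
    together.\<close>
  define flip where "flip k l \<longleftrightarrow> {k, l} \<subseteq> cells lv \<Delta> \<and> k \<delta>0 = i \<delta>0 \<and>
      (\<forall>D\<in>\<D>. \<forall>\<delta>\<in>D. \<forall>\<epsilon>\<in>D. k \<delta> = i \<delta> \<and> l \<delta> = j \<delta> \<and> k \<epsilon> = i \<epsilon> \<and> l \<epsilon> = j \<epsilon> \<or>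
        k \<delta> = j \<delta> \<and> l \<delta> = i \<delta> \<and> k \<epsilon> = j \<epsilon> \<and> l \<epsilon> = i \<epsilon>)" for k l
  have flipI: "flip k l \<or> flip l k"
    if "{k, l} \<subseteq> cells lv \<Delta>" "\<forall>D\<in>\<D>. margin D {#k, l#} = margin D {#i, j#}" for k l
  proof -
    have *: "k \<delta> = i \<delta> \<and> l \<delta> = j \<delta> \<and> k \<epsilon> = i \<epsilon> \<and> l \<epsilon> = j \<epsilon> \<or>
        k \<delta> = j \<delta> \<and> l \<delta> = i \<delta> \<and> k \<epsilon> = j \<epsilon> \<and> l \<epsilon> = i \<epsilon>"
      if "D \<in> \<D>" "\<delta> \<in> D" "\<epsilon> \<in> D" for D \<delta> \<epsilon>
    proof -
      have "restrict k D = restrict i D \<and> restrict l D = restrict j D \<or>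
          restrict k D = restrict j D \<and> restrict l D = restrict i D"
        using that(1) \<open>\<forall>D\<in>\<D>. margin D {#k, l#} = margin D {#i, j#}\<close>
        by (simp add: mset_pair_eq_iff)
      then show ?thesis using that(2,3) by (metis restrict_apply')
    qed
    obtain D where "D \<in> \<D>" "\<delta>0 \<in> D" using d0(1) un by blast
    then have "k \<delta>0 = i \<delta>0 \<or> l \<delta>0 = i \<delta>0" using * by blast
    then show ?thesis
    proof
      assume "k \<delta>0 = i \<delta>0"
      then show ?thesis using * that(1) unfolding flip_def by blast
    next
      assume "l \<delta>0 = i \<delta>0"
      then have "flip l k" using * that(1) unfolding flip_def by (simp; blast)
      then show ?thesis ..
    qed
  qed
  have single: "k \<delta> = i \<delta> \<and> l \<delta> = j \<delta> \<or> k \<delta> = j \<delta> \<and> l \<delta> = i \<delta>" if "flip k l" "\<delta> \<in> \<Delta>" for k l \<delta>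
    using that un unfolding flip_def by blast
  have pair: "k \<delta> = i \<delta> \<and> k \<epsilon> = i \<epsilon> \<or> k \<delta> = j \<delta> \<and> k \<epsilon> = j \<epsilon>"
    if f: "flip k l" and D: "D \<in> \<D>" "\<delta> \<in> D" "\<epsilon> \<in> D" for k l D \<delta> \<epsilon>
    using f[unfolded flip_def, THEN conjunct2, THEN conjunct2, rule_format, OF D] by blast
  have nonadj: "\<not> {\<delta>0, \<delta>} \<subseteq> D" if "flip k l" "k \<delta> \<noteq> i \<delta>" "D \<in> \<D>" for k l \<delta> D
  proof
    assume "{\<delta>0, \<delta>} \<subseteq> D"
    then have "k \<delta>0 = i \<delta>0 \<and> k \<delta> = i \<delta> \<or> k \<delta>0 = j \<delta>0"
      using pair[OF that(1,3), of \<delta>0 \<delta>] by blast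
    then show False using that d0(2) by (auto simp: flip_def)
  qed
  \<comment> \<open>Only the first pair exchanges \<open>\<delta>\<close>, while the second
    exchanges \<open>\<epsilon>\<close>. A clique containing both would make the second pair
    exchange both or neither, so \<open>\<delta>0, \<delta>, \<epsilon>\<close> would be
    independent.\<close>
  have contra: False
    if f: "flip k l" "flip m n" and d: "\<delta> \<in> \<Delta>" "\<epsilon> \<in> \<Delta>"
      and v: "k \<delta> \<noteq> i \<delta>" "m \<epsilon> \<noteq> i \<epsilon>" "m \<delta> = i \<delta>" for k l m n \<delta> \<epsilon>
  proof -
    have ne: "\<delta> \<noteq> \<epsilon>" "\<delta> \<noteq> \<delta>0" "\<epsilon> \<noteq> \<delta>0" "i \<delta> \<noteq> j \<delta>"
      using v f single[OF f(1) d(1)] by (auto simp: flip_def)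
    then obtain D where D: "D \<in> \<D>" "{\<delta>0, \<delta>} \<subseteq> D \<or> {\<delta>0, \<epsilon>} \<subseteq> D \<or> {\<delta>, \<epsilon>} \<subseteq> D"
      using no3[OF d0(1) d(1,2)] by auto
    then have "{\<delta>, \<epsilon>} \<subseteq> D"
      using nonadj[OF f(1) v(1)] nonadj[OF f(2) v(2)] by blast
    then have "m \<delta> = i \<delta> \<and> m \<epsilon> = i \<epsilon> \<or> m \<delta> = j \<delta>"
      using pair[OF f(2) D(1), of \<delta> \<epsilon>] by blast
    then show False using v ne by auto
  qed
  have main: "{#k, l#} = {#i, j#} \<or> {#m, n#} = {#i, j#} \<or> {#k, l#} = {#m, n#}"
    if f: "flip k l" "flip m n" for k l m n
  proof (rule ccontr)
    assume n: "\<not> ?thesis"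
    note ext = cells_ext[of _ lv \<Delta>]
    have fst_eq: "l = j" if "flip k l" "k = i" for k l
    proof (rule ext)
      fix \<delta> assume "\<delta> \<in> \<Delta>"
      then show "l \<delta> = j \<delta>" using single[OF that(1)] that(2) by force
    qed (use that c in \<open>auto simp: flip_def\<close>)
    have "k \<noteq> i" "m \<noteq> i" using n fst_eq f by auto
    moreover have "k \<in> cells lv \<Delta>" "m \<in> cells lv \<Delta>" "i \<in> cells lv \<Delta>"
      using f c by (auto simp: flip_def)
    ultimately obtain \<delta> \<epsilon> where d: "\<delta> \<in> \<Delta>" "k \<delta> \<noteq> i \<delta>" and e: "\<epsilon> \<in> \<Delta>" "m \<epsilon> \<noteq> i \<epsilon>"
      using ext by metis
    \<comment> \<open>Where \<open>m\<close> and \<open>k\<close> differ, exactly one of them is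
      exchanged, and the other is exchanged somewhere else, so \<open>contra\<close> applies in one
      of its two orders.\<close>
    have "m \<zeta> = k \<zeta>" if "\<zeta> \<in> \<Delta>" for \<zeta>
      using contra[OF f that e(1) _ e(2)] contra[OF f(2,1) that d(1) _ d(2)]
        single[OF f(1) that] single[OF f(2) that] by metis
    moreover from this have "n \<zeta> = l \<zeta>" if "\<zeta> \<in> \<Delta>" for \<zeta>
      using single[OF f(1) that] single[OF f(2) that] that by (metis (full_types))
    ultimately have "m = k" "n = l" using f by (auto simp: flip_def intro!: ext)
    then show False using n by simp
  qed
  have comm: "{#l, k#} = {#k, l#}" "{#n, m#} = {#m, n#}" by (simp_all add: add_mset_commute)
  have "flip k l \<or> flip l k" "flip m n \<or> flip n m"
    using flipI[OF _ kl] flipI[OF _ mn] c by simp_all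
  then show ?thesis
    using main[of k l m n] main[of l k m n] main[of k l n m] main[of l k n m]
    unfolding comm by argo
qed

section \<open>Moves forced by connectivity\<close>

lemma rtrancl_leaves:
  assumes "(x, y) \<in> R\<^sup>*" "x \<in> K" "y \<notin> K"
  obtains u w where "u \<in> K" "w \<notin> K" "(u, w) \<in> R" "(x, u) \<in> R\<^sup>*"
proof -
  have "\<exists>u w. u \<in> K \<and> w \<notin> K \<and> (u, w) \<in> R \<and> (x, u) \<in> R\<^sup>*"
    using assms(1,3)
  proof induction
    case base
    then show ?case using assms(2) by blast
  next
    case (step y z)
    then show ?case by (cases "y \<in> K") blast+
  qed
  then show ?thesis using that by blast
qed

lemma uminus_table_diff:
  "(\<lambda>i. - (x i - y i)) = (\<lambda>i. y i - (x i :: int))"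
  by auto

lemma fiber_stepsD:
  assumes "(u, w) \<in> fiber_steps F M"
  shows "(\<lambda>i. u i - w i) \<in> M \<or> (\<lambda>i. w i - u i) \<in> M"
proof -
  obtain z where z: "z \<in> M" "(\<forall>i. w i = u i + z i) \<or> (\<forall>i. w i = u i - z i)"
    using assms by (auto simp: fiber_steps_def)
  then have "z = (\<lambda>i. w i - u i) \<or> z = (\<lambda>i. u i - w i)" by (auto simp: fun_eq_iff)
  then show ?thesis using z(1) by auto
qed

text \<open>The form in which connectedness of a fiber is used: a Markov basis has to leave every
  proper part \<open>K\<close> of it.\<close>

lemma markov_basis_leaves:
  assumes M: "markov_basis \<Delta> lv \<D> M" and fin: "finite \<Delta>" and un: "\<Union>\<D> \<subseteq> \<Delta>"
    and XY: "set_mset X \<subseteq> cells lv \<Delta>" "set_mset Y \<subseteq> cells lv \<Delta>" "\<forall>D\<in>\<D>. margin D X = margin D Y"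
    and K: "X \<in> K" "Y \<notin> K"
  obtains U W where "U \<in> K" "W \<notin> K" "set_mset W \<subseteq> cells lv \<Delta>" "\<forall>D\<in>\<D>. margin D W = margin D X"
    "(\<lambda>i. table_of U i - table_of W i) \<in> M \<or> (\<lambda>i. table_of W i - table_of U i) \<in> M"
proof -
  let ?R = "fiber_steps (tables \<Delta> lv) M"
  have "(table_of X, table_of Y) \<in> ?R\<^sup>*"
    using M XY marginal_freqs_table_of[OF fin un XY(1,2)] by (auto simp: markov_basis_iff)
  then obtain u w where uw: "u \<in> table_of ` K" "w \<notin> table_of ` K" "(u, w) \<in> ?R" "(table_of X, u) \<in> ?R\<^sup>*"
    by (rule rtrancl_leaves[where K = "table_of ` K"]) (use K in auto)
  obtain U where U: "U \<in> K" "u = table_of U" using uw(1) by blast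
  have "w \<in> tables \<Delta> lv" using uw(3) by (auto simp: fiber_steps_def)
  then obtain W where W: "w = table_of W" "set_mset W \<subseteq> cells lv \<Delta>" by (rule tableE[OF fin])
  have "M \<subseteq> moves \<Delta> lv \<D>" using M by (simp add: markov_basis_iff)
  then have "marginal_freqs \<Delta> lv \<D> (table_of X) = marginal_freqs \<Delta> lv \<D> (table_of W)"
    using table_steps_rtrancl_marginal_freqs rtrancl_into_rtrancl[OF uw(4,3)] W(1) by metis
  then have "\<forall>D\<in>\<D>. margin D W = margin D X"
    unfolding marginal_freqs_table_of[OF fin un XY(1) W(2)] by simp
  moreover have "W \<notin> K" using uw(2) W(1) by blast
  ultimately show ?thesis
    using that U W fiber_stepsD[OF uw(3)] by blast
qed

lemma sign_class_mem:
  assumes "z \<in> M \<or> (\<lambda>i. - z i) \<in> M"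
  shows "{z, (\<lambda>i. - z i)} \<in> sign_classes M"
  using assms
proof
  assume "(\<lambda>i. - z i) \<in> M"
  then show ?thesis
    unfolding sign_classes_def by (rule rev_image_eqI) (simp add: insert_commute)
qed (simp add: sign_classes_def)

lemma sign_class_memD:
  assumes "{z, (\<lambda>i. - z i)} \<in> sign_classes M"
  shows "z \<in> M \<or> (\<lambda>i. - z i) \<in> M"
proof -
  obtain y where y: "y \<in> M" "{z, (\<lambda>i. - z i)} = {y, (\<lambda>i. - y i)}"
    using assms unfolding sign_classes_def by blast
  then have "y = z \<or> y = (\<lambda>i. - z i)" by blast
  then show ?thesis using y(1) by blast
qed

lemma size_two_msetE:
  assumes "size X = 2"
  obtains a b where "X = {#a, b#}"
proof -
  obtain a Y where "X = add_mset a Y"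
    using assms size_eq_Suc_imp_eq_union[of X 1] by auto
  moreover from this obtain b where "Y = {#b#}"
    using assms size_1_singleton_mset[of Y] by auto
  ultimately show ?thesis using that by blast
qed

text \<open>A least Markov basis, ordered by inclusion of sign classes, is minimal, and no other
  basis can be minimal beside it.\<close>

lemma minimal_and_unique_if_contained:
  assumes M: "markov_basis \<Delta> lv \<D> M"
    and sub: "\<And>N. markov_basis \<Delta> lv \<D> N \<Longrightarrow> sign_classes M \<subseteq> sign_classes N"
  shows "minimal_markov_basis \<Delta> lv \<D> M" "unique_minimal_markov_basis \<Delta> lv \<D>"
proof -
  show min: "minimal_markov_basis \<Delta> lv \<D> M"
    using M sub unfolding minimal_markov_basis_def by blast
  show "unique_minimal_markov_basis \<Delta> lv \<D>"
    unfolding unique_minimal_markov_basis_def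
  proof (rule ex1I)
    show "\<exists>N. minimal_markov_basis \<Delta> lv \<D> N \<and> sign_classes M = sign_classes N"
      using min by blast
    fix B assume "\<exists>N. minimal_markov_basis \<Delta> lv \<D> N \<and> B = sign_classes N"
    then obtain N where N: "minimal_markov_basis \<Delta> lv \<D> N" "B = sign_classes N" by blast
    then have "sign_classes M \<subseteq> sign_classes N" using sub by (simp add: minimal_markov_basis_def)
    then show "B = sign_classes M" using N M unfolding minimal_markov_basis_def by blast
  qed
qed

text \<open>The positive and the negative part of a primitive move make up their whole fiber, so a
  Markov basis can leave the first part only along this very move.\<close>

lemma sign_classes_subset_if_two_element_fibers:
  assumes fin: "finite \<Delta>" and un: "\<Union>\<D> = \<Delta>" and N: "markov_basis \<Delta> lv \<D> N"
    and M: "M \<subseteq> primitive_moves \<Delta> lv \<D>" and ne: "\<D> \<noteq> {}"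
    and no3: "\<And>a b c. a \<in> \<Delta> \<Longrightarrow> b \<in> \<Delta> \<Longrightarrow> c \<in> \<Delta> \<Longrightarrow> distinct [a, b, c] \<Longrightarrow>
      \<exists>D\<in>\<D>. {a, b} \<subseteq> D \<or> {a, c} \<subseteq> D \<or> {b, c} \<subseteq> D"
  shows "sign_classes M \<subseteq> sign_classes N"
proof -
  have un': "\<Union>\<D> \<subseteq> \<Delta>" using un by simp
  have "z \<in> N \<or> (\<lambda>i. - z i) \<in> N" if z: "z \<in> M" for z
  proof -
    have zp: "z \<in> primitive_moves \<Delta> lv \<D>" using z M by blast
    obtain i j k l where ijkl: "{i, j, k, l} \<subseteq> cells lv \<Delta>" "distinct [i, j, k, l]"
      "z = (\<lambda>t. table_of {#i, j#} t - table_of {#k, l#} t)"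
      using zp by (rule primitive_moveE)
    let ?X = "{#i, j#}" and ?Y = "{#k, l#}"
    have c: "set_mset ?X \<subseteq> cells lv \<Delta>" "set_mset ?Y \<subseteq> cells lv \<Delta>" using ijkl(1) by auto
    have XY: "\<forall>D\<in>\<D>. margin D ?X = margin D ?Y"
      using zp diff_moves_iff[OF fin un' c] unfolding ijkl(3) primitive_moves_def by blast
    have "?Y \<notin> {?X}" using ijkl(2) by (auto simp: mset_pair_eq_iff)
    then obtain U W where UW: "U \<in> {?X}" "W \<notin> {?X}" "set_mset W \<subseteq> cells lv \<Delta>"
      "\<forall>D\<in>\<D>. margin D W = margin D ?X"
      "(\<lambda>i. table_of U i - table_of W i) \<in> N \<or> (\<lambda>i. table_of W i - table_of U i) \<in> N"
      using markov_basis_leaves[OF N fin un' c XY, of "{?X}"] by blast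
    obtain D where "D \<in> \<D>" using ne by blast
    \<comment> \<open>A margin determines the total, so the table reached has two cells as
      well.\<close>
    then have "size W = 2" using UW(4) margin_simps(4)[of D W] margin_simps(4)[of D ?X] by simp
    then obtain m n where W: "W = {#m, n#}"
      by (rule size_two_msetE)
    have "?Y = ?X \<or> W = ?X \<or> ?Y = W"
      unfolding W
    proof (rule degree_two_fiber_le_two[OF un _ _ _ no3])
      show "{i, j, k, l, m, n} \<subseteq> cells lv \<Delta>" using ijkl(1) UW(3) by (simp add: W)
    qed (use XY UW(4) in \<open>simp_all add: W\<close>)
    then have "W = ?Y" using \<open>?Y \<notin> {?X}\<close> UW(2) by auto
    then show ?thesis
      using UW(1,5) unfolding ijkl(3) uminus_table_diff by auto
  qed
  then show ?thesis unfolding sign_classes_def[of M] using sign_class_mem by blast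
qed

section \<open>Exchanging moves\<close>

lemma markov_basis_exchange:
  assumes M: "markov_basis \<Delta> lv \<D> M" and K: "finite K" "K \<subseteq> moves \<Delta> lv \<D>"
    and z: "z = (\<lambda>i. u i - v i)" and uv: "u \<in> tables \<Delta> lv" "v \<in> tables \<Delta> lv" "\<And>i. u i = 0 \<or> v i = 0"
    and N: "N = M - {z, (\<lambda>i. - z i)} \<union> K"
    and path: "(u, v) \<in> (fiber_steps (tables \<Delta> lv) N)\<^sup>*"
  shows "markov_basis \<Delta> lv \<D> N"
proof (rule markov_basis_replace[OF M])
  show "finite N" "N \<subseteq> moves \<Delta> lv \<D>"
    using M K by (auto simp: markov_basis_iff N)
  fix y assume y: "y \<in> M"
  have nonneg: "0 \<le> u i" "0 \<le> v i" for i using uv by (auto simp: tables_def)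
  consider "y = z" | "y = (\<lambda>i. - z i)" | "y \<in> N" using y N by blast
  then show "\<exists>u v. (u, v) \<in> (fiber_steps (tables \<Delta> lv) N)\<^sup>* \<and>
      (\<forall>i. y i = u i - v i \<and> 0 \<le> u i \<and> 0 \<le> v i \<and> (u i = 0 \<or> v i = 0))"
  proof cases
    case 1
    then show ?thesis
      using path nonneg uv(3) by (intro exI[of _ u] exI[of _ v]) (simp add: z)
  next
    case 2
    then show ?thesis
      using fiber_steps_rtrancl_sym[OF path] nonneg uv(3)
      by (intro exI[of _ v] exI[of _ u]) (auto simp: z)
  next
    case 3
    \<comment> \<open>A retained move simulates itself, as a single step between its positive and
      its negative part.\<close>
    let ?u = "\<lambda>i. max (y i) 0" and ?v = "\<lambda>i. max (- y i) 0"
    have "y \<in> arrays \<Delta> lv" using y M by (auto simp: markov_basis_iff moves_def)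
    then have "?u \<in> tables \<Delta> lv" "?v \<in> tables \<Delta> lv" by (auto simp: tables_def arrays_def)
    then have "(?u, ?v) \<in> fiber_steps (tables \<Delta> lv) N"
      using 3 by (intro fiber_stepsI[where z = y]) auto
    then show ?thesis by (intro exI[of _ ?u] exI[of _ ?v]) auto
  qed
qed

lemma minimal_markov_basis_no_detour:
  assumes M: "minimal_markov_basis \<Delta> lv \<D> M" and z: "z \<in> M" "z = (\<lambda>i. u i - v i)"
    and uv: "u \<in> tables \<Delta> lv" "v \<in> tables \<Delta> lv" "\<And>i. u i = 0 \<or> v i = 0"
  shows "(u, v) \<notin> (fiber_steps (tables \<Delta> lv) (M - {z, (\<lambda>i. - z i)}))\<^sup>*"
proof
  let ?N = "M - {z, (\<lambda>i. - z i)}"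
  assume "(u, v) \<in> (fiber_steps (tables \<Delta> lv) ?N)\<^sup>*"
  moreover have "markov_basis \<Delta> lv \<D> M" using M by (simp add: minimal_markov_basis_def)
  moreover have "?N = ?N \<union> {}" by simp
  ultimately have "markov_basis \<Delta> lv \<D> ?N"
    using markov_basis_exchange[OF _ finite.emptyI empty_subsetI z(2) uv] by blast
  moreover have "{z, (\<lambda>i. - z i)} \<notin> sign_classes ?N"
    using sign_class_memD[of z ?N] by blast
  moreover have "{z, (\<lambda>i. - z i)} \<in> sign_classes M"
    using sign_class_mem z(1) by blast
  moreover have "sign_classes ?N \<subseteq> sign_classes M" unfolding sign_classes_def by blast
  ultimately show False using M unfolding minimal_markov_basis_def by blast
qed

abbreviation table_diff :: "'c multiset \<Rightarrow> 'c multiset \<Rightarrow> 'c \<Rightarrow> int" where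
  "table_diff X Y \<equiv> \<lambda>i. table_of X i - table_of Y i"

text \<open>A cell in which only one of the tables is nonzero tells the moves apart. This certifies
  that a detour does not reuse the move it is meant to replace.\<close>

lemma table_diff_neq:
  assumes "r \<in># R" "r \<notin># X" "r \<notin># Y" "r \<notin># Z"
  shows "table_diff Z R \<noteq> table_diff X Y" "table_diff R Z \<noteq> table_diff X Y"
proof -
  have "table_diff X Y r = 0" "table_diff Z R r \<noteq> 0" "table_diff R Z r \<noteq> 0"
    using assms by (auto simp: table_of_def not_in_iff)
  then show "table_diff Z R \<noteq> table_diff X Y" "table_diff R Z \<noteq> table_diff X Y" by metis+
qed

lemma table_of_disjoint:
  "set_mset X \<inter> set_mset Y = {} \<Longrightarrow> table_of X i = 0 \<or> table_of Y i = 0"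
  by (auto simp: table_of_def count_eq_zero_iff)

text \<open>A move between two elements of a fiber can be traded for a detour through a third one.\<close>

lemma unique_minimal_avoids_third_element:
  assumes fin: "finite \<Delta>" and un: "\<Union>\<D> \<subseteq> \<Delta>"
    and uniq: "unique_minimal_markov_basis \<Delta> lv \<D>" and M: "minimal_markov_basis \<Delta> lv \<D> M"
    and c: "set_mset X \<subseteq> cells lv \<Delta>" "set_mset Y \<subseteq> cells lv \<Delta>" "set_mset R \<subseteq> cells lv \<Delta>"
    and XR: "\<forall>D\<in>\<D>. margin D X = margin D R" and RY: "\<forall>D\<in>\<D>. margin D R = margin D Y"
    and disj: "set_mset X \<inter> set_mset Y = {}" "set_mset X \<inter> set_mset R = {}" "set_mset Y \<inter> set_mset R = {}"
    and R: "R \<noteq> {#}"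
  shows "table_diff X Y \<notin> M"
proof
  let ?z = "table_diff X Y"
  assume z: "?z \<in> M"
  let ?K = "{table_diff X R, table_diff R Y}" and ?N = "M - {?z, (\<lambda>i. - ?z i)} \<union> {table_diff X R, table_diff R Y}"
  let ?S = "fiber_steps (tables \<Delta> lv) ?N"
  have K: "?K \<subseteq> moves \<Delta> lv \<D>"
    using diff_moves_iff[OF fin un c(1,3)] diff_moves_iff[OF fin un c(3,2)] XR RY by simp
  have "(table_of X, table_of R) \<in> ?S"
    using c by (intro fiber_stepsI[where z = "table_diff X R"]) simp_all
  moreover have "(table_of R, table_of Y) \<in> ?S"
    using c by (intro fiber_stepsI[where z = "table_diff R Y"]) simp_all
  ultimately have path: "(table_of X, table_of Y) \<in> ?S\<^sup>*" by (meson converse_rtrancl_into_rtrancl r_into_rtrancl)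
  have N: "markov_basis \<Delta> lv \<D> ?N"
  proof (rule markov_basis_exchange[OF _ _ K refl _ _ _ refl path])
    show "markov_basis \<Delta> lv \<D> M" using M by (simp add: minimal_markov_basis_def)
    show "table_of X i = 0 \<or> table_of Y i = 0" for i using disj(1) by (rule table_of_disjoint)
  qed (use c in simp_all)
  \<comment> \<open>A cell of the third table shows that neither half of the detour is the traded
    move or its negative.\<close>
  obtain r where r: "r \<in># R" "r \<notin># X" "r \<notin># Y" using R disj by (metis IntI empty_iff multiset_nonemptyE)
  have "?z \<notin> ?N" "(\<lambda>i. - ?z i) \<notin> ?N"
    unfolding uminus_table_diff
    using table_diff_neq[OF r(1,2,3,2)] table_diff_neq[OF r(1,2,3,3)]
      table_diff_neq[OF r(1,3,2,2)] table_diff_neq[OF r(1,3,2,3)] by auto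
  then have "{?z, (\<lambda>i. - ?z i)} \<notin> sign_classes ?N" using sign_class_memD by blast
  \<comment> \<open>A minimal basis inside the exchanged one lacks the class of \<open>?z\<close>,
    whereas uniqueness would make it agree with \<open>M\<close>.\<close>
  moreover obtain M' where M': "minimal_markov_basis \<Delta> lv \<D> M'" "sign_classes M' \<subseteq> sign_classes ?N"
    using exists_minimal_markov_basis[OF N] .
  moreover have "sign_classes M' = sign_classes M"
    using uniq M M'(1) unfolding unique_minimal_markov_basis_def by blast
  moreover have "{?z, (\<lambda>i. - ?z i)} \<in> sign_classes M" using sign_class_mem z by blast
  ultimately show False by blast
qed

section \<open>The fiber of an independent triple\<close>

locale independent_triple =
  fixes \<Delta> :: "'v set" and lv :: "'v \<Rightarrow> nat" and \<D> :: "'v set set" and T :: "'v set"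
  assumes fin: "finite \<Delta>" and un: "\<Union>\<D> = \<Delta>" and ne: "\<D> \<noteq> {}"
    and lv: "\<And>\<delta>. \<delta> \<in> \<Delta> \<Longrightarrow> 2 \<le> lv \<delta>"
    and T: "T \<subseteq> \<Delta>" "card T = 3"
    and indep: "\<And>D u v. D \<in> \<D> \<Longrightarrow> u \<in> T \<inter> D \<Longrightarrow> v \<in> T \<inter> D \<Longrightarrow> u = v"
begin

definition cell :: "'v set \<Rightarrow> 'v \<Rightarrow> nat" where
  "cell p = (\<lambda>\<delta>\<in>\<Delta>. if \<delta> \<in> p then 1 else 0)"

text \<open>Complementary subsets of \<open>T\<close> give the same table, so its eight subsets
  encode four tables.\<close>

definition tab :: "'v set \<Rightarrow> ('v \<Rightarrow> nat) multiset" where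
  "tab p = {#cell p, cell (T - p)#}"

lemma un': "\<Union>\<D> \<subseteq> \<Delta>" using un by simp

lemma cell_cells: "cell p \<in> cells lv \<Delta>"
proof -
  have "0 < lv \<delta>" "1 < lv \<delta>" if "\<delta> \<in> \<Delta>" for \<delta> using lv[OF that] by auto
  then show ?thesis unfolding cell_def cells_def by auto
qed

lemma restrict_cell_iff:
  assumes "D \<subseteq> \<Delta>"
  shows "restrict (cell p) D = restrict (cell p') D \<longleftrightarrow> p \<inter> D = p' \<inter> D"
proof -
  have "restrict (cell p) D = restrict (cell p') D \<longleftrightarrow> (\<forall>\<delta>\<in>D. \<delta> \<in> p \<longleftrightarrow> \<delta> \<in> p')"
    using assms by (auto simp: fun_eq_iff cell_def restrict_def)
  then show ?thesis by blast
qed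

lemma cell_eq_iff: "p \<subseteq> \<Delta> \<Longrightarrow> p' \<subseteq> \<Delta> \<Longrightarrow> cell p = cell p' \<longleftrightarrow> p = p'"
  using restrict_cell_iff[of \<Delta> p p'] restrict_cell_same[OF cell_cells] by (simp add: Int_absorb2)

lemma tab_cells: "set_mset (tab p) \<subseteq> cells lv \<Delta>"
  using cell_cells by (simp add: tab_def)

lemma margin_tab_eq_iff:
  assumes "D \<subseteq> \<Delta>"
  shows "margin D (tab s) = margin D (tab t) \<longleftrightarrow>
    s \<inter> D = t \<inter> D \<and> (T - s) \<inter> D = (T - t) \<inter> D \<or> s \<inter> D = (T - t) \<inter> D \<and> (T - s) \<inter> D = t \<inter> D"
  by (simp add: tab_def mset_pair_eq_iff restrict_cell_iff[OF assms])

text \<open>A clique meets \<open>T\<close> in at most one vertex, so it sees one cell with 0 and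
  one with 1 there, but not how the values at different vertices are combined.\<close>

lemma tab_same_fiber:
  assumes "s \<subseteq> T" "t \<subseteq> T"
  shows "\<forall>D\<in>\<D>. margin D (tab s) = margin D (tab t)"
proof
  fix D assume D: "D \<in> \<D>"
  then have "D \<subseteq> \<Delta>" using un by blast
  then show "margin D (tab s) = margin D (tab t)"
    unfolding margin_tab_eq_iff[OF \<open>D \<subseteq> \<Delta>\<close>] using indep[OF D] assms by blast
qed

lemma tab_disjoint:
  assumes "s \<subseteq> T" "t \<subseteq> T" "s \<noteq> t" "s \<noteq> T - t"
  shows "set_mset (tab s) \<inter> set_mset (tab t) = {}"
proof -
  have "T - s \<noteq> t" "T - s \<noteq> T - t" using assms by blast+
  moreover have "s \<subseteq> \<Delta>" "t \<subseteq> \<Delta>" "T - s \<subseteq> \<Delta>" "T - t \<subseteq> \<Delta>" using assms T by blast+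
  ultimately show ?thesis using assms(3,4) by (simp add: tab_def cell_eq_iff)
qed

lemma tab_compl: "t \<subseteq> T \<Longrightarrow> tab (T - t) = tab t"
  by (simp add: tab_def double_diff add_mset_commute)

text \<open>The margin of a clique containing \<open>\<delta>\<close> determines the two values at
  \<open>\<delta>\<close> up to order: 0 and 1 on \<open>T\<close>, both 0 elsewhere. Only the set
  where the first cell has value 1 remains free.\<close>

lemma fiber_tab:
  assumes X: "set_mset X \<subseteq> cells lv \<Delta>" and m: "\<forall>D\<in>\<D>. margin D X = margin D (tab {})"
  shows "\<exists>p\<subseteq>T. X = tab p"
proof -
  obtain D where "D \<in> \<D>" using ne by blast
  then have "size X = 2"
    using m margin_simps(4)[of D X] margin_simps(4)[of D "tab {}"] by (simp add: tab_def)
  then obtain k l where kl: "X = {#k, l#}" by (rule size_two_msetE)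
  have v: "k \<delta> = 0 \<and> l \<delta> = (if \<delta> \<in> T then 1 else 0) \<or> k \<delta> = (if \<delta> \<in> T then 1 else 0) \<and> l \<delta> = 0"
    if d: "\<delta> \<in> \<Delta>" for \<delta>
  proof -
    obtain D where D: "D \<in> \<D>" "\<delta> \<in> D" using d un by blast
    then have "restrict k D = restrict (cell {}) D \<and> restrict l D = restrict (cell T) D \<or>
        restrict k D = restrict (cell T) D \<and> restrict l D = restrict (cell {}) D"
      using m by (simp add: kl tab_def mset_pair_eq_iff)
    then have "k \<delta> = cell {} \<delta> \<and> l \<delta> = cell T \<delta> \<or> k \<delta> = cell T \<delta> \<and> l \<delta> = cell {} \<delta>"
      using D(2) by (metis restrict_apply')
    then show ?thesis using d by (simp add: cell_def)
  qed
  define p where "p = {\<delta> \<in> T. k \<delta> = 1}"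
  have "k \<delta> = cell p \<delta>" "l \<delta> = cell (T - p) \<delta>" if "\<delta> \<in> \<Delta>" for \<delta>
    using v[OF that] that by (auto simp: cell_def p_def split: if_splits)
  then have "k = cell p" "l = cell (T - p)"
    using X cell_cells by (auto simp: kl intro!: cells_ext[of _ lv \<Delta>])
  moreover have "p \<subseteq> T" by (auto simp: p_def)
  ultimately show ?thesis using kl by (auto simp: tab_def)
qed

lemma fiber_tab_cases:
  assumes X: "set_mset X \<subseteq> cells lv \<Delta>" and m: "\<forall>D\<in>\<D>. margin D X = margin D (tab {})"
    and abc: "T = {a, b, c}"
  shows "X \<in> {tab {}, tab {a}, tab {b}, tab {c}}"
proof -
  obtain p where p: "p \<subseteq> T" "X = tab p" using fiber_tab[OF X m] by blast
  have d: "a \<noteq> b" "a \<noteq> c" "b \<noteq> c" using T(2) unfolding abc by (auto simp: card_insert_if split: if_splits)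
  have "p \<in> Pow {a, b, c}" using p(1) abc by blast
  \<comment> \<open>Of two complementary subsets of a triple, one has at most one element.\<close>
  then have "p \<in> {{}, {a}, {b}, {c}} \<or> T - p \<in> {{}, {a}, {b}, {c}}"
    unfolding abc by (auto simp: Pow_insert d d[symmetric] insert_Diff_if)
  then have "X \<in> tab ` {{}, {a}, {b}, {c}}"
    using p(2) tab_compl[OF p(1)] by (metis image_eqI)
  then show ?thesis by simp
qed

text \<open>The four cells involved are pairwise distinct, so equality of margins alone makes the
  difference primitive.\<close>

lemma table_diff_tab_primitive_iff:
  assumes st: "s \<subseteq> T" "t \<subseteq> T" "s \<noteq> t" "s \<noteq> T - t" and G: "\<Union>G \<subseteq> \<Delta>"
  shows "table_diff (tab s) (tab t) \<in> primitive_moves \<Delta> lv G \<longleftrightarrow> (\<forall>D\<in>G. margin D (tab s) = margin D (tab t))"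
proof
  assume "table_diff (tab s) (tab t) \<in> primitive_moves \<Delta> lv G"
  then show "\<forall>D\<in>G. margin D (tab s) = margin D (tab t)"
    using diff_moves_iff[OF fin G tab_cells tab_cells, of s t] by (simp add: primitive_moves_def)
next
  assume m: "\<forall>D\<in>G. margin D (tab s) = margin D (tab t)"
  have "cell p \<noteq> cell (T - p)" if "p \<subseteq> T" for p
  proof -
    have "T \<noteq> {}" using T(2) by auto
    then have "p \<noteq> T - p" using that by blast
    moreover have "p \<subseteq> \<Delta>" "T - p \<subseteq> \<Delta>" using that T(1) by blast+
    ultimately show ?thesis by (simp add: cell_eq_iff)
  qed
  then have "distinct [cell s, cell (T - s), cell t, cell (T - t)]"
    using tab_disjoint[OF st] st(1,2) by (auto simp: tab_def)
  then show "table_diff (tab s) (tab t) \<in> primitive_moves \<Delta> lv G"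
    using m unfolding tab_def by (intro primitive_moveI[OF fin G]) (simp_all add: cell_cells)
qed

text \<open>Flipping the coordinate \<open>c\<close> exchanges the two moves.\<close>

lemma parallel_primitive_moves:
  assumes abc: "T = {a, b, c}" and G: "\<Union>G \<subseteq> \<Delta>"
  shows "table_diff (tab {}) (tab {a}) \<in> primitive_moves \<Delta> lv G \<longleftrightarrow>
    table_diff (tab {b}) (tab {c}) \<in> primitive_moves \<Delta> lv G"
proof -
  have d: "a \<noteq> b" "a \<noteq> c" "b \<noteq> c" using T(2) unfolding abc by (auto simp: card_insert_if split: if_splits)
  have "margin D (tab {}) = margin D (tab {a}) \<longleftrightarrow> margin D (tab {b}) = margin D (tab {c})" if "D \<in> G" for D
  proof -
    have "D \<subseteq> \<Delta>" using that G by blast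
    note m = margin_tab_eq_iff[OF this]
    show ?thesis
      unfolding m unfolding abc by (cases "a \<in> D"; cases "b \<in> D"; cases "c \<in> D") (use d in auto)
  qed
  moreover have ne: "{} \<noteq> {a}" "{} \<noteq> T - {a}" "{b} \<noteq> {c}" "{b} \<noteq> T - {c}" using d abc by auto
  have sub: "{} \<subseteq> T" "{a} \<subseteq> T" "{b} \<subseteq> T" "{c} \<subseteq> T" using abc by auto
  note table_diff_tab_primitive_iff[OF sub(1,2) ne(1,2) G] table_diff_tab_primitive_iff[OF sub(3,4) ne(3,4) G]
  ultimately show ?thesis by blast
qed

text \<open>Some move must lead away from \<open>tab {}\<close>, yet uniqueness excludes all three
  candidates, since each has a detour through another table of the fiber.\<close>

lemma not_unique_minimal_markov_basis: "\<not> unique_minimal_markov_basis \<Delta> lv \<D>"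
proof
  assume uniq: "unique_minimal_markov_basis \<Delta> lv \<D>"
  then obtain M where M: "minimal_markov_basis \<Delta> lv \<D> M"
    unfolding unique_minimal_markov_basis_def by blast
  then have "markov_basis \<Delta> lv \<D> M" by (simp add: minimal_markov_basis_def)
  note leaves = markov_basis_leaves[OF this fin un' tab_cells tab_cells tab_same_fiber]
  obtain a b c where abc: "T = {a, b, c}" "a \<noteq> b" "a \<noteq> c" "b \<noteq> c"
    using T(2) by (auto simp: card_3_iff)
  have ne: "tab {} \<noteq> tab t" "{} \<noteq> t" "{} \<noteq> T - t" if "t \<in> {{a}, {b}, {c}}" for t
  proof -
    show "{} \<noteq> t" "{} \<noteq> T - t" using that abc by auto
    then have "set_mset (tab {}) \<inter> set_mset (tab t) = {}"
      using that abc(1) by (intro tab_disjoint) auto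
    then show "tab {} \<noteq> tab t" by (auto simp: tab_def mset_pair_eq_iff)
  qed
  have avoid: "table_diff (tab {}) (tab t) \<notin> M \<and> table_diff (tab t) (tab {}) \<notin> M"
    if t: "t \<in> {{a}, {b}, {c}}" for t
  proof -
    obtain r where r: "r \<in> {{a}, {b}, {c}}" "r \<noteq> t" using abc by blast
    have sub: "{} \<subseteq> T" "t \<subseteq> T" "r \<subseteq> T" using t r(1) abc(1) by auto
    \<comment> \<open>The tables of two singletons could coincide only if these were complementary,
      which their sizes forbid.\<close>
    have "card t = 1" "card r = 1" using t r(1) by auto
    then have "card (T - r) = 2" using T(2) card_Diff_subset[OF _ sub(3)] card_ge_0_finite[of r] by simp
    then have tr: "t \<noteq> T - r" using \<open>card t = 1\<close> by auto
    note disj = tab_disjoint[OF sub(1,2) ne(2,3)[OF t]] tab_disjoint[OF sub(1,3) ne(2,3)[OF r(1)]]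
      tab_disjoint[OF sub(2,3) r(2)[symmetric] tr]
    have "tab r \<noteq> {#}" by (simp add: tab_def)
    note avoids = unique_minimal_avoids_third_element[OF fin un' uniq M tab_cells tab_cells tab_cells
        tab_same_fiber tab_same_fiber]
    show ?thesis
      using avoids[of "{}" r t] avoids[of t r "{}"] sub disj \<open>tab r \<noteq> {#}\<close>
      by (simp add: Int_commute)
  qed
  have "tab {a} \<notin> {tab {}}" using ne(1)[of "{a}"] by auto
  then obtain U W where "U \<in> {tab {}}" "W \<notin> {tab {}}" "set_mset W \<subseteq> cells lv \<Delta>"
    "\<forall>D\<in>\<D>. margin D W = margin D (tab {})" "table_diff U W \<in> M \<or> table_diff W U \<in> M"
    using leaves[of "{}" "{a}" "{tab {}}"] abc(1) by blast
  then show False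
    using fiber_tab_cases[OF _ _ abc(1), of W] avoid by auto
qed

text \<open>The four tables of the fiber are the vertices of a complete graph whose edges come in three
  parallel classes. A union of sets of primitive moves contains a class or misses it, so that one
  class does not connect the fiber and two classes form a 4-cycle.\<close>

lemma union_of_primitive_moves_not_minimal:
  assumes G: "\<And>e. e \<in> E \<Longrightarrow> \<Union>(G e) \<subseteq> \<Delta>" and M: "M = (\<Union>e\<in>E. primitive_moves \<Delta> lv (G e))"
  shows "\<not> minimal_markov_basis \<Delta> lv \<D> M"
proof
  assume min: "minimal_markov_basis \<Delta> lv \<D> M"
  then have mb: "markov_basis \<Delta> lv \<D> M" by (simp add: minimal_markov_basis_def)
  note leaves = markov_basis_leaves[OF mb fin un' tab_cells tab_cells tab_same_fiber]
  have M_sym: "table_diff X Y \<in> M \<longleftrightarrow> table_diff Y X \<in> M" for X Y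
  proof -
    have "(\<lambda>i. - z i) \<in> M" if "z \<in> M" for z
      using that primitive_moves_uminus unfolding M by blast
    from this[of "table_diff X Y"] this[of "table_diff Y X"] show ?thesis
      unfolding uminus_table_diff by iprover
  qed
  have parallel: "table_diff (tab {}) (tab {a}) \<in> M \<longleftrightarrow> table_diff (tab {b}) (tab {c}) \<in> M"
    if "T = {a, b, c}" for a b c
    using parallel_primitive_moves[OF that G] unfolding M by blast
  \<comment> \<open>With two classes present, the edge from \<open>{}\<close> to \<open>{a}\<close>
    is bypassed by \<open>{}\<close>, \<open>{b}\<close>, \<open>{c}\<close>, \<open>{a}\<close>:
    the middle edge is its own parallel, and the outer two belong to the other class.\<close>
  have two: False
    if abc: "T = {a, b, c}" and e: "table_diff (tab {}) (tab {a}) \<in> M" "table_diff (tab {}) (tab {b}) \<in> M" "a \<noteq> b"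
    for a b c
  proof -
    have d: "a \<noteq> b" "a \<noteq> c" "b \<noteq> c" using T(2) unfolding abc by (auto simp: card_insert_if split: if_splits)
    let ?z = "table_diff (tab {}) (tab {a})"
    let ?S = "fiber_steps (tables \<Delta> lv) (M - {?z, (\<lambda>i. - ?z i)})"
    have sub: "{} \<subseteq> T" "{a} \<subseteq> T" "{b} \<subseteq> T" "{c} \<subseteq> T" using abc by auto
    have ne: "{} \<noteq> {a}" "{} \<noteq> T - {a}" "{b} \<noteq> {}" "{b} \<noteq> T - {}" "{c} \<noteq> {}" "{c} \<noteq> T - {}"
      "{b} \<noteq> {a}" "{b} \<noteq> T - {a}" "{c} \<noteq> {a}" "{c} \<noteq> T - {a}" "{c} \<noteq> {b}" "{c} \<noteq> T - {b}"
      using abc d by auto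
    \<comment> \<open>Each edge of the bypass touches \<open>tab {b}\<close> or
      \<open>tab {c}\<close>, whose cells do not occur in the removed move.\<close>
    have mem: "cell {b} \<in># tab {b}" "cell {c} \<in># tab {c}" by (auto simp: tab_def)
    have notin: "cell {b} \<notin># tab {}" "cell {b} \<notin># tab {a}" "cell {c} \<notin># tab {}" "cell {c} \<notin># tab {a}"
      "cell {c} \<notin># tab {b}"
      using mem tab_disjoint[OF sub(3,1) ne(3,4)] tab_disjoint[OF sub(4,1) ne(5,6)]
        tab_disjoint[OF sub(3,2) ne(7,8)] tab_disjoint[OF sub(4,2) ne(9,10)]
        tab_disjoint[OF sub(4,3) ne(11,12)] by blast+
    have step: "(table_of (tab s), table_of (tab t)) \<in> ?S"
      if "table_diff (tab s) (tab t) \<in> M" "table_diff (tab s) (tab t) \<noteq> ?z"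
        "table_diff (tab s) (tab t) \<noteq> table_diff (tab {a}) (tab {})" for s t
      using that by (intro fiber_stepsI[where z = "table_diff (tab s) (tab t)"])
        (simp_all add: tab_cells uminus_table_diff)
    have "(table_of (tab {}), table_of (tab {b})) \<in> ?S"
      using e(2) table_diff_neq(1)[OF mem(1) notin(1,2,1)] table_diff_neq(1)[OF mem(1) notin(2,1,1)]
      by (intro step)
    moreover have "table_diff (tab {b}) (tab {c}) \<in> M" using parallel[OF abc] e(1) by simp
    then have "(table_of (tab {b}), table_of (tab {c})) \<in> ?S"
      using table_diff_neq(1)[OF mem(2) notin(3,4,5)] table_diff_neq(1)[OF mem(2) notin(4,3,5)]
      by (intro step)
    moreover have "T = {b, c, a}" using abc by auto
    then have "table_diff (tab {c}) (tab {a}) \<in> M" using parallel[of b c a] e(2) by simp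
    then have "(table_of (tab {c}), table_of (tab {a})) \<in> ?S"
      using table_diff_neq(2)[OF mem(2) notin(3,4,4)] table_diff_neq(2)[OF mem(2) notin(4,3,4)]
      by (intro step)
    ultimately have "(table_of (tab {}), table_of (tab {a})) \<in> ?S\<^sup>*"
      by (meson converse_rtrancl_into_rtrancl r_into_rtrancl)
    moreover have "table_of (tab {}) i = 0 \<or> table_of (tab {a}) i = 0" for i
      using tab_disjoint[OF sub(1,2) ne(1,2)] by (rule table_of_disjoint)
    ultimately show False
      using minimal_markov_basis_no_detour[OF min e(1) refl] tab_cells by simp
  qed
  \<comment> \<open>A single class only pairs \<open>tab {}\<close> with \<open>tab {a}\<close> and
    \<open>tab {b}\<close> with \<open>tab {c}\<close>, so the first pair could not be left.\<close>
  have one: "table_diff (tab {}) (tab {a}) \<notin> M" if abc: "T = {a, b, c}" for a b c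
  proof
    assume e: "table_diff (tab {}) (tab {a}) \<in> M"
    have d: "a \<noteq> b" "a \<noteq> c" "b \<noteq> c" using T(2) unfolding abc by (auto simp: card_insert_if split: if_splits)
    have perm: "T = {a, c, b}" "T = {b, c, a}" "T = {c, a, b}" using abc by auto
    have no: "table_diff (tab {}) (tab {b}) \<notin> M" "table_diff (tab {}) (tab {c}) \<notin> M"
      using two[OF abc e] two[OF perm(1) e] d by blast+
    have no': "table_diff (tab {c}) (tab {a}) \<notin> M" "table_diff (tab {a}) (tab {b}) \<notin> M"
      using parallel[OF perm(2)] parallel[OF perm(3)] no by blast+
    have sub: "{} \<subseteq> T" "{a} \<subseteq> T" "{b} \<subseteq> T" using abc by auto
    have ne: "{b} \<noteq> {}" "{b} \<noteq> T - {}" "{b} \<noteq> {a}" "{b} \<noteq> T - {a}" using abc d by auto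
    have "cell {b} \<in># tab {b}" by (simp add: tab_def)
    then have "tab {b} \<notin> {tab {}, tab {a}}"
      using tab_disjoint[OF sub(3,1) ne(1,2)] tab_disjoint[OF sub(3,2) ne(3,4)] by auto
    then obtain U W where "U \<in> {tab {}, tab {a}}" "W \<notin> {tab {}, tab {a}}" "set_mset W \<subseteq> cells lv \<Delta>"
      "\<forall>D\<in>\<D>. margin D W = margin D (tab {})" "table_diff U W \<in> M \<or> table_diff W U \<in> M"
      using leaves[OF sub(1,3), of "{tab {}, tab {a}}"] by blast
    then show False
      using fiber_tab_cases[OF _ _ abc, of W] no no' M_sym by auto
  qed
  obtain a b c where abc: "T = {a, b, c}" using T(2) by (auto simp: card_3_iff)
  have perm: "T = {b, c, a}" "T = {c, a, b}" using abc by auto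
  have sub: "{} \<subseteq> T" "{a} \<subseteq> T" using abc by auto
  have "{a} \<noteq> T - {}" using T(2) by auto
  then have "set_mset (tab {a}) \<inter> set_mset (tab {}) = {}" by (intro tab_disjoint sub) simp
  then have "tab {a} \<notin> {tab {}}" by (auto simp: tab_def mset_pair_eq_iff)
  \<comment> \<open>Some edge at \<open>tab {}\<close> must be present, although every class has
    just been excluded.\<close>
  then obtain U W where "U \<in> {tab {}}" "W \<notin> {tab {}}" "set_mset W \<subseteq> cells lv \<Delta>"
    "\<forall>D\<in>\<D>. margin D W = margin D (tab {})" "table_diff U W \<in> M \<or> table_diff W U \<in> M"
    using leaves[OF sub, of "{tab {}}"] by blast
  then show False
    using fiber_tab_cases[OF _ _ abc, of W] one[OF abc] one[OF perm(1)] one[OF perm(2)] M_sym by auto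
qed

end

section \<open>The equivalence, decided by the presence of an independent triple\<close>

lemma Union_edge_generating_class: "\<Union>(edge_generating_class \<D> E e) \<subseteq> \<Union>\<D>"
proof -
  have "component \<D> E' D \<subseteq> \<D>" for E' D
    by (auto simp: component_def is_path_def)
  then show ?thesis unfolding edge_generating_class_def by blast
qed

theorem theorem4:
  fixes m :: nat and lv :: "nat \<Rightarrow> nat" and \<D> :: "nat set set"
  assumes "1 \<le> m"
    and "\<forall>\<delta>\<in>{1..m}. 2 \<le> lv \<delta>"
    and "generating_class {1..m} \<D>"
    and "decomposable {1..m} \<D>"
  shows "(\<exists>E. clique_tree \<D> E \<and>
             minimal_markov_basis {1..m} lv \<D> (clique_tree_moves {1..m} lv \<D> E))
         \<longleftrightarrow> unique_minimal_markov_basis {1..m} lv \<D>"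
proof -
  let ?\<Delta> = "{1..m}" and ?E = "independence_edges \<D>"
  have fin: "finite ?\<Delta>" by simp
  have un: "\<Union>\<D> = ?\<Delta>" using assms(3) by (simp add: generating_class_def)
  have ne: "\<D> \<noteq> {}" using un assms(1) by auto
  have max: "maximal_cliques ?\<Delta> ?E = \<D>" and ch: "chordal ?\<Delta> ?E"
    using assms(4) by (simp_all add: decomposable_def)
  have sg: "simple_graph ?\<Delta> ?E" using un by (intro simple_graph_independence_edges) simp
  show ?thesis
  \<comment> \<open>Adjacency in the independence graph is membership in a common generator, so the
    first case says that no independent triple exists. Both sides hold in this case, and both fail
    in the other.\<close>
  proof (cases "\<forall>a\<in>?\<Delta>. \<forall>b\<in>?\<Delta>. \<forall>c\<in>?\<Delta>. distinct [a, b, c] \<longrightarrow>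
      (\<exists>D\<in>\<D>. {a, b} \<subseteq> D \<or> {a, c} \<subseteq> D \<or> {b, c} \<subseteq> D)")
    case True
    have no3: "\<exists>D\<in>\<D>. {a, b} \<subseteq> D \<or> {a, c} \<subseteq> D \<or> {b, c} \<subseteq> D"
      if "a \<in> ?\<Delta>" "b \<in> ?\<Delta>" "c \<in> ?\<Delta>" "distinct [a, b, c]" for a b c
      using True[rule_format, OF that] .
    have edge: "{a, b} \<in> ?E" if "{a, b} \<subseteq> D" "D \<in> \<D>" "a \<noteq> b" for a b D
      using that unfolding independence_edges_def by blast
    obtain A B where AB: "?\<Delta> = A \<union> B" "clique A ?E" "clique B ?E"
    proof (rule two_clique_cover[OF fin sg ch])
      fix a b c assume "a \<in> ?\<Delta>" "b \<in> ?\<Delta>" "c \<in> ?\<Delta>" and d: "distinct [a, b, c]"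
      then obtain D where "D \<in> \<D>" "{a, b} \<subseteq> D \<or> {a, c} \<subseteq> D \<or> {b, c} \<subseteq> D" using no3 by blast
      moreover have "a \<noteq> b" "a \<noteq> c" "b \<noteq> c" using d by auto
      ultimately show "{a, b} \<in> ?E \<or> {a, c} \<in> ?E \<or> {b, c} \<in> ?E" using edge by blast
    qed
    obtain cs where cs: "distinct cs" "set cs = \<D>"
      and int: "\<And>i j k. i \<le> j \<Longrightarrow> j \<le> k \<Longrightarrow> k < length cs \<Longrightarrow> cs ! i \<inter> cs ! k \<subseteq> cs ! j"
      using clique_order[OF fin sg ch AB] unfolding max by blast
    have "cs \<noteq> []" using cs(2) ne by auto
    let ?M = "clique_tree_moves ?\<Delta> lv \<D> (path_edges cs)"
    have M: "markov_basis ?\<Delta> lv \<D> ?M"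
      by (rule markov_basis_clique_tree_moves_path[OF fin un cs(1) \<open>cs \<noteq> []\<close> cs(2) int])
    have sub: "sign_classes ?M \<subseteq> sign_classes N" if "markov_basis ?\<Delta> lv \<D> N" for N
      using clique_tree_moves_path_primitive[OF fin un cs(1) \<open>cs \<noteq> []\<close> cs(2) int]
      by (intro sign_classes_subset_if_two_element_fibers[OF fin un that _ ne no3])
    have "clique_tree \<D> (path_edges cs)"
      by (rule clique_tree_path_edges[OF cs(1) \<open>cs \<noteq> []\<close> cs(2) int])
    then show ?thesis using minimal_and_unique_if_contained[OF M sub] by blast
  next
    case False
    then obtain a b c where "a \<in> ?\<Delta>" "b \<in> ?\<Delta>" "c \<in> ?\<Delta>" and abc: "distinct [a, b, c]"
      "\<not> (\<exists>D\<in>\<D>. {a, b} \<subseteq> D \<or> {a, c} \<subseteq> D \<or> {b, c} \<subseteq> D)"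
      unfolding ball_simps not_imp by blast
    then have sub: "{a, b, c} \<subseteq> ?\<Delta>" by blast
    interpret independent_triple ?\<Delta> lv \<D> "{a, b, c}"
    proof
      show "card {a, b, c} = 3" using abc(1) by simp
      fix D u v assume "D \<in> \<D>" "u \<in> {a, b, c} \<inter> D" "v \<in> {a, b, c} \<inter> D"
      then show "u = v" using abc(2) by blast
    qed (use fin un ne assms(2) sub in auto)
    \<comment> \<open>Each edge contributes a full set of primitive moves of some model on \<Delta>,
      which is the form required by \<open>union_of_primitive_moves_not_minimal\<close>.\<close>
    have "\<not> minimal_markov_basis ?\<Delta> lv \<D> (clique_tree_moves ?\<Delta> lv \<D> E)" for E
      using Union_edge_generating_class[of \<D> E] un
      by (intro union_of_primitive_moves_not_minimal[OF _ clique_tree_moves_def]) simp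
    then show ?thesis using not_unique_minimal_markov_basis by blast
  qed
qed

end
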